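(* For every connected subcubic graph $G$, the graph $D(G)$ has a packing $8$-coloring in which color $8$ is used at most once (that is, a packing $8$-coloring $V_1,\ldots,V_8$ of $D(G)$ with $|V_8|\le 1$).
   Context: Graphs are finite and simple. A graph is subcubic if its maximum degree is at most $3$. For a graph $G$, $D(G)$ denotes the graph obtained from $G$ by subdividing every edge once (replacing every edge $xy$ by a path $x,z_{xy},y$ with a new vertex $z_{xy}$ of degree $2$). A packing $k$-coloring of a graph $H$ is a partition of $V(H)$ into sets $V_1,\ldots,V_k$ (some possibly empty; vertices in $V_i$ are said to have color $i$) such that for each $1\le i\le k$ the distance in $H$ between any two distinct vertices of $V_i$ is at least $i+1$. *)

theory Defs
  imports "Graph_Theory.Graph_Theory" "HOL-Library.Disjoint_Sets"
begin

(* A finite simple graph is a "pair_graph": a finite, loop-free digraph without parallel arcs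
   whose arc relation is symmetric, each edge xy being the two arcs (x,y) and (y,x).
   Hence the degree of a vertex is its out-degree. *)

definition subcubic :: "('a, 'b) pre_digraph \<Rightarrow> bool" where
  "subcubic G \<longleftrightarrow> (\<forall>v \<in> verts G. out_degree G v \<le> 3)"

(* Shortest-path distance with unit arc weights; infinite if there is no walk from u to v. *)
definition graph_dist :: "('a, 'b) pre_digraph \<Rightarrow> 'a \<Rightarrow> 'a \<Rightarrow> ereal" where
  "graph_dist G u v = wf_digraph.\<mu> G (\<lambda>_. 1) u v"

(* The subdivision vertex of the edge xy is Inr {x, y}. As the arc relation of G is symmetric
   and {x, y} = {y, x}, each edge of G contributes one new vertex, adjacent to both ends. *)
definition subdivide_edges :: "'a pair_pre_digraph \<Rightarrow> ('a + 'a set) pair_pre_digraph" where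
  "subdivide_edges G =
     \<lparr> pverts = Inl ` pverts G \<union> {Inr {x, y} | x y. (x, y) \<in> parcs G},
       parcs = {(Inl x, Inr {x, y}) | x y. (x, y) \<in> parcs G}
             \<union> {(Inr {x, y}, Inl x) | x y. (x, y) \<in> parcs G} \<rparr>"

definition packing_coloring ::
    "nat \<Rightarrow> ('a, 'b) pre_digraph \<Rightarrow> (nat \<Rightarrow> 'a set) \<Rightarrow> bool" where
  "packing_coloring k H V \<longleftrightarrow>
     disjoint_family_on V {1..k} \<and>
     (\<Union>i\<in>{1..k}. V i) = verts H \<and>
     (\<forall>i\<in>{1..k}. \<forall>u\<in>V i. \<forall>v\<in>V i. u \<noteq> v \<longrightarrow> ereal (real i + 1) \<le> graph_dist H u v)"

lemma (in wf_digraph) awalk_cost_unit: "awalk_cost (\<lambda>_. 1) p = real (length p)"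
  by (induction p) auto

lemma (in wf_digraph) le_graph_dist_iff:
  "ereal (real n) \<le> graph_dist G u v \<longleftrightarrow> (\<forall>p. awalk u p v \<longrightarrow> n \<le> length p)"
  by (auto simp: graph_dist_def \<mu>_def le_INF_iff awalk_cost_unit)

lemma pair_graph_subdivide_edges:
  assumes "pair_graph G"
  shows "pair_graph (subdivide_edges G)"
proof -
  interpret pair_graph G by fact
  have "finite ((\<lambda>(x, y). Inr {x, y} :: 'a + 'a set) ` parcs G)"
    and "finite ((\<lambda>(x, y). (Inl x, Inr {x, y}) :: ('a + 'a set) \<times> ('a + 'a set)) ` parcs G)"
    and "finite ((\<lambda>(x, y). (Inr {x, y}, Inl x) :: ('a + 'a set) \<times> ('a + 'a set)) ` parcs G)"
    using pair_finite_arcs by auto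
  moreover have "{Inr {x, y} :: 'a + 'a set | x y. (x, y) \<in> parcs G}
      = (\<lambda>(x, y). Inr {x, y}) ` parcs G"
    and "{(Inl x, Inr {x, y}) :: ('a + 'a set) \<times> ('a + 'a set) | x y. (x, y) \<in> parcs G}
      = (\<lambda>(x, y). (Inl x, Inr {x, y})) ` parcs G"
    and "{(Inr {x, y}, Inl x) :: ('a + 'a set) \<times> ('a + 'a set) | x y. (x, y) \<in> parcs G}
      = (\<lambda>(x, y). (Inr {x, y}, Inl x)) ` parcs G"
    by force+
  ultimately show ?thesis
    using pair_finite_verts
    by unfold_locales
      (auto simp: subdivide_edges_def symmetric_def sym_def dest: in_arcsD1)
qed

lemma subdivide_edges_adj_ends:
  assumes "pair_graph G" and "(x, y) \<in> parcs G"
  shows "{w. (Inr {x, y}, w) \<in> parcs (subdivide_edges G)} = {Inl x, Inl y}"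
proof -
  interpret pair_graph G by fact
  have "(y, x) \<in> parcs G"
    using assms(2) pair_sym_arcs by (simp add: symmetric_def symD)
  with assms(2) show ?thesis
    by (auto simp: subdivide_edges_def doubleton_eq_iff)
qed

end

theory Submission
  imports Defs
begin

text \<open>
  Every subdivision vertex gets colour 1. Distances between original vertices double in the
  subdivision, so it remains to give all vertices of \<open>G\<close> except one a colour in \<open>{2..7}\<close>
  such that vertices of the same colour have distance at least 2 in \<open>G\<close> for the colours 2, 3, at
  least 3 for 4, 5 and at least 4 for 6, 7; the exceptional vertex \<open>r\<close> gets colour 8. We take for
  \<open>r\<close> a vertex that is not a cut vertex and colour \<open>V(G) - {r}\<close> by induction over connected
  sets \<open>S\<close> with an edge leaving them. The invariant (\<open>good S z f\<close> below) is that all vertices of \<open>S\<close>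
  with a neighbour outside \<open>S\<close> have colour 2 or 3, with the exception of one prescribed vertex
  \<open>z\<close>, which may also have colour 4 or 5. Under it, colourings of different components of
  a set hardly interact.

  For the induction step we remove \<open>v = z\<close> and, if \<open>S - {v}\<close> is still connected, also a neighbour
  \<open>w1\<close> of \<open>v\<close>; the other neighbour \<open>w2\<close> of \<open>v\<close> is the prescribed vertex of the rest. The critical
  case is that the two remaining neighbours \<open>x\<close>, \<open>y\<close> of \<open>w1\<close> carry the two different colours 2
  and 3. If neither \<open>w1\<close> nor, after \<open>w1\<close> has taken over its colour, \<open>x\<close> or \<open>y\<close> can be
  given colour 4 or 5, then the vertices with the colours 4 and 5 that block this occupy so many
  of the places near \<open>w1\<close> that one of the colours 6 and 7 is free for \<open>w1\<close>.
\<close>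

section \<open>Colours and distances\<close>

text \<open>Two vertices of the same colour \<open>c \<in> {2..7}\<close> must have distance more than \<open>rad c\<close> in \<open>G\<close>.
  We call \<open>rad c\<close> the class of \<open>c\<close>; the other colour of the class is \<open>5 - c\<close>, \<open>9 - c\<close> and
  \<open>13 - c\<close> for the classes 1, 2 and 3.\<close>

definition rad :: "nat \<Rightarrow> nat" where "rad c = c div 2"

lemma rad_1_iff: "rad c = 1 \<longleftrightarrow> c = 2 \<or> c = 3"
  and rad_2_iff: "rad c = 2 \<longleftrightarrow> c = 4 \<or> c = 5"
  and rad_3_iff: "rad c = 3 \<longleftrightarrow> c = 6 \<or> c = 7"
  by (auto simp: rad_def)

lemma rad_simps [simp]:
  "rad 2 = 1" "rad 3 = 1" "rad 4 = 2" "rad 5 = 2" "rad 6 = 3" "rad 7 = 3"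
  by (simp_all add: rad_def)

lemma rad_cases: "c \<in> {2..7} \<Longrightarrow> rad c = 1 \<or> rad c = 2 \<or> rad c = 3"
  by (auto simp: rad_def)

lemma rad_opp: "rad c = 1 \<Longrightarrow> rad (5 - c) = 1" "rad c = 1 \<Longrightarrow> 5 - c \<noteq> c"
  "rad c = 1 \<Longrightarrow> 5 - (5 - c) = c"
  "rad c = 1 \<Longrightarrow> rad d = 1 \<Longrightarrow> d \<noteq> c \<Longrightarrow> d = 5 - c"
  unfolding rad_1_iff by auto

lemma rad_opp2: "rad c = 2 \<Longrightarrow> rad (9 - c) = 2" "rad c = 2 \<Longrightarrow> 9 - c \<noteq> c"
  "rad c = 2 \<Longrightarrow> 9 - (9 - c) = c"
  "rad c = 2 \<Longrightarrow> rad d = 2 \<Longrightarrow> d \<noteq> c \<Longrightarrow> d = 9 - c"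
  unfolding rad_2_iff by auto

lemma rad_range: "rad c = 1 \<Longrightarrow> c \<in> {2..7}" "rad c = 2 \<Longrightarrow> c \<in> {2..7}" "rad c = 3 \<Longrightarrow> c \<in> {2..7}"
  by (auto simp: rad_def)

locale subcubic_adjacency =
  fixes E :: "'a \<Rightarrow> 'a \<Rightarrow> bool"
  assumes adj_sym: "E a b \<Longrightarrow> E b a"
    and adj_irrefl: "\<not> E a a"
    and finite_nbrs: "finite {b. E a b}"
    and card_nbrs: "card {b. E a b} \<le> 3"
begin

lemma nbr_cases:
  assumes "E x a" "E x b" "E x c" "a \<noteq> b" "a \<noteq> c" "b \<noteq> c" "E x d"
  shows "d = a \<or> d = b \<or> d = c"
proof -
  have "{a, b, c} = {y. E x y}"
    using assms card_nbrs[of x] by (intro card_seteq[OF finite_nbrs]) auto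
  with assms(7) show ?thesis by auto
qed

primrec near :: "nat \<Rightarrow> 'a \<Rightarrow> 'a \<Rightarrow> bool" where
  "near 0 a b \<longleftrightarrow> a = b"
| "near (Suc k) a b \<longleftrightarrow> a = b \<or> (\<exists>c. E a c \<and> near k c b)"

lemma near_1: "near 1 a b \<longleftrightarrow> a = b \<or> E a b"
  by auto

lemma near_2: "near 2 a b \<longleftrightarrow> a = b \<or> E a b \<or> (\<exists>c. E a c \<and> E c b)"
  by (auto simp: numeral_2_eq_2)

lemma near_3: "near 3 a b \<longleftrightarrow> a = b \<or> E a b \<or> (\<exists>c. E a c \<and> E c b) \<or> (\<exists>c d. E a c \<and> E c d \<and> E d b)"
  by (auto simp: numeral_3_eq_3)

lemma near_sym:
  assumes "near k a b" shows "near k b a"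
proof -
  have snoc: "near (Suc k) a c" if "near k a b" "E b c" for k a b c
    using that by (induction k arbitrary: a) auto
  have refl: "near k a a" for k a by (cases k) auto
  show ?thesis
    using assms
  proof (induction k arbitrary: a)
    case (Suc k)
    then consider "a = b" | c where "E a c" "near k c b" by auto
    then show ?case
    proof cases
      case 2
      with Suc.IH snoc adj_sym show ?thesis by blast
    qed (use refl in auto)
  qed simp
qed

text \<open>Distances are measured in the whole graph and not inside \<open>S\<close>, so colouring
  one more vertex only requires checks at that vertex.\<close>

definition valid :: "'a set \<Rightarrow> ('a \<Rightarrow> nat) \<Rightarrow> bool" where
  "valid S f \<longleftrightarrow> (\<forall>a\<in>S. f a \<in> {2..7}) \<and>
     (\<forall>a\<in>S. \<forall>b\<in>S. a \<noteq> b \<longrightarrow> f a = f b \<longrightarrow> \<not> near (rad (f a)) a b)"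

lemma validD: "valid S f \<Longrightarrow> a \<in> S \<Longrightarrow> b \<in> S \<Longrightarrow> a \<noteq> b \<Longrightarrow> f a = f b \<Longrightarrow> \<not> near (rad (f a)) a b"
  by (auto simp: valid_def)

lemma valid_range: "valid S f \<Longrightarrow> a \<in> S \<Longrightarrow> f a \<in> {2..7}"
  by (auto simp: valid_def)

lemma valid_rad: "valid S f \<Longrightarrow> a \<in> S \<Longrightarrow> rad (f a) = 1 \<or> rad (f a) = 2 \<or> rad (f a) = 3"
  using valid_range rad_cases by blast

lemma valid_adj: "valid S f \<Longrightarrow> a \<in> S \<Longrightarrow> b \<in> S \<Longrightarrow> E a b \<Longrightarrow> f a \<noteq> f b"
  using validD[of S f a b] valid_rad[of S f a] adj_irrefl
  by (metis near_1 near_2 near_3)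

lemma valid_mono: "valid S f \<Longrightarrow> S' \<subseteq> S \<Longrightarrow> valid S' f"
  unfolding valid_def by blast

lemma valid_upd:
  assumes "valid (S - {a}) f" "c \<in> {2..7}"
    and "\<And>b. b \<in> S \<Longrightarrow> b \<noteq> a \<Longrightarrow> f b = c \<Longrightarrow> \<not> near (rad c) a b"
  shows "valid S (f(a := c))"
  using assms unfolding valid_def by (auto dest: near_sym)

lemma valid_upd1:
  assumes "valid (S - {a}) f" "rad c = 1" "\<And>b. b \<in> S \<Longrightarrow> E a b \<Longrightarrow> f b \<noteq> c"
  shows "valid S (f(a := c))"
  using assms rad_range(1)[of c] by (intro valid_upd) (auto simp: near_1[simplified] adj_irrefl)

lemma valid_upd2:
  assumes "valid (S - {a}) f" "rad c = 2"
    and "\<And>b. b \<in> S \<Longrightarrow> b \<noteq> a \<Longrightarrow> near 2 a b \<Longrightarrow> f b \<noteq> c"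
  shows "valid S (f(a := c))"
  using assms rad_range(2)[of c] by (intro valid_upd) auto

section \<open>Connected sets\<close>

text \<open>Connectedness of the subgraph induced by \<open>S\<close>, expressed by cuts.\<close>

definition conn :: "'a set \<Rightarrow> bool" where
  "conn S \<longleftrightarrow> (\<forall>A. A \<subseteq> S \<longrightarrow> A \<noteq> {} \<longrightarrow> A \<noteq> S \<longrightarrow> (\<exists>a\<in>A. \<exists>b\<in>S - A. E a b))"

lemma conn_insert:
  assumes "conn S" "s \<in> S" "E b s" shows "conn (insert b S)"
  unfolding conn_def
proof (intro allI impI)
  fix A assume A: "A \<subseteq> insert b S" "A \<noteq> {}" "A \<noteq> insert b S"
  show "\<exists>a\<in>A. \<exists>c\<in>insert b S - A. E a c"
  proof (cases "A \<inter> S = {} \<or> S \<subseteq> A")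
    case True
    with A assms(2,3) adj_sym show ?thesis by blast
  next
    case False
    then have "A \<inter> S \<noteq> {}" "A \<inter> S \<noteq> S" by auto
    then obtain a c where "a \<in> A \<inter> S" "c \<in> S - A \<inter> S" "E a c"
      using assms(1)[unfolded conn_def, rule_format, of "A \<inter> S"] by auto
    then show ?thesis by blast
  qed
qed

text \<open>A largest connected proper subset stays connected when an adjacent vertex is added, so
  it then is all of \<open>V\<close>; the vertex added last is no cut vertex. The empty set counts
  as connected.\<close>

lemma ex_noncut:
  assumes "finite V" "V \<noteq> {}" "conn V"
  shows "\<exists>r\<in>V. conn (V - {r})"
proof -
  define P where "P S \<longleftrightarrow> S \<subset> V \<and> conn S" for S
  have "P {}" using assms(2) by (auto simp: P_def conn_def)
  moreover have "\<forall>S. P S \<longrightarrow> card S < Suc (card V)"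
    using assms(1) by (auto simp: P_def less_Suc_eq_le intro: card_mono)
  ultimately have "\<exists>S. P S \<and> (\<forall>S'. P S' \<longrightarrow> card S' \<le> card S)"
    by (rule ex_has_greatest_nat[where f = card])
  then obtain S where "P S" and max: "\<And>S'. P S' \<Longrightarrow> card S' \<le> card S"
    by blast
  then have S: "S \<subset> V" "conn S" by (auto simp: P_def)
  obtain b where b: "b \<in> V - S" "S = {} \<or> (\<exists>s\<in>S. E b s)"
  proof (cases "S = {}")
    case True
    with assms(2) that show ?thesis by auto
  next
    case False
    then have "\<exists>a\<in>S. \<exists>b\<in>V - S. E a b"
      using S assms(3)[unfolded conn_def, rule_format, of S] by auto
    with that adj_sym show ?thesis by blast
  qed
  have "conn (insert b S)"
  proof (cases "S = {}")
    case True
    then show ?thesis unfolding conn_def by blast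
  next
    case False
    with b(2) S(2) conn_insert show ?thesis by blast
  qed
  moreover have "card (insert b S) = Suc (card S)"
    using b(1) S(1) finite_subset[of S V] assms(1) by (intro card_insert_disjoint) auto
  ultimately have "insert b S = V"
    using S(1) max[of "insert b S"] b(1) unfolding P_def by fastforce
  then have "V - {b} = S" using b(1) by auto
  then show ?thesis using S(2) b(1) by blast
qed

lemma conn_remove_leaf:
  assumes S: "conn S" "v \<in> S" and leaf: "\<And>a b. a \<in> S \<Longrightarrow> b \<in> S \<Longrightarrow> E v a \<Longrightarrow> E v b \<Longrightarrow> a = b"
  shows "conn (S - {v})"
  unfolding conn_def
proof (intro allI impI)
  fix A assume A: "A \<subseteq> S - {v}" "A \<noteq> {}" "A \<noteq> S - {v}"
  show "\<exists>a\<in>A. \<exists>b\<in>S - {v} - A. E a b"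
  proof (cases "\<exists>a\<in>A. E v a")
    case True
    \<comment> \<open>\<open>A\<close> contains the only neighbour of \<open>v\<close>, so the cut
      is applied to the other side, whose leaving edge cannot end at \<open>v\<close>.\<close>
    have "S - {v} - A \<subseteq> S" "S - {v} - A \<noteq> {}" "S - {v} - A \<noteq> S" using A S(2) by auto
    then obtain a b where ab: "a \<in> S - {v} - A" "b \<in> S - (S - {v} - A)" "E a b"
      using S(1)[unfolded conn_def, rule_format, of "S - {v} - A"] by auto
    moreover have "b \<noteq> v" using ab True leaf adj_sym A(1) by blast
    ultimately show ?thesis using adj_sym by blast
  next
    case False
    have "A \<subseteq> S" "A \<noteq> S" using A S(2) by auto
    then obtain a b where ab: "a \<in> A" "b \<in> S - A" "E a b"
      using S(1)[unfolded conn_def, rule_format, of A] A(2) by auto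
    moreover have "b \<noteq> v" using ab False adj_sym by blast
    ultimately show ?thesis by blast
  qed
qed

lemma conn_nbr:
  assumes "conn S" "v \<in> S" "S \<noteq> {v}" shows "\<exists>a\<in>S - {v}. E v a"
  using assms(1)[unfolded conn_def, rule_format, of "{v}"] assms(2,3) by auto

text \<open>Three pairwise separated parts of \<^term>\<open>S - {v}\<close> would each contain a neighbour of \<^term>\<open>v\<close>.\<close>

lemma conn_split:
  assumes S: "conn S" "v \<in> S" and nb: "\<And>a. a \<in> S \<Longrightarrow> E v a \<Longrightarrow> a = p \<or> a = q"
    and nc: "\<not> conn (S - {v})"
  shows "\<exists>A B. A \<union> B = S - {v} \<and> A \<inter> B = {} \<and> (\<forall>a\<in>A. \<forall>b\<in>B. \<not> E a b) \<and>
     conn A \<and> conn B \<and> p \<in> A \<and> q \<in> B"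
proof -
  \<comment> \<open>A union of components of \<open>S - {v}\<close> can be left inside
    \<open>S\<close> only through \<open>v\<close>.\<close>
  have touch: "p \<in> X \<or> q \<in> X"
    if "X \<subseteq> S - {v}" "X \<noteq> {}" "\<And>a b. a \<in> X \<Longrightarrow> b \<in> S - {v} - X \<Longrightarrow> \<not> E a b" for X
  proof -
    have "X \<noteq> S" using that S by auto
    then obtain a b where "a \<in> X" "b \<in> S - X" "E a b"
      using S(1)[unfolded conn_def, rule_format, of X] \<open>X \<subseteq> S - {v}\<close> \<open>X \<noteq> {}\<close> by auto
    with that have "b = v" by auto
    with \<open>E a b\<close> \<open>a \<in> X\<close> that(1) nb adj_sym show ?thesis by blast
  qed
  obtain A0 where A0: "A0 \<subseteq> S - {v}" "A0 \<noteq> {}" "A0 \<noteq> S - {v}" "\<forall>a\<in>A0. \<forall>b\<in>S - {v} - A0. \<not> E a b"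
    using nc unfolding conn_def by blast
  define B0 where "B0 = S - {v} - A0"
  have cn: "conn X" if X: "X \<subseteq> S - {v}" "\<forall>a\<in>X. \<forall>b\<in>S - {v} - X. \<not> E a b" 
      "X \<noteq> S - {v}" for X
    unfolding conn_def
  proof (intro allI impI, rule ccontr)
    fix C assume C: "C \<subseteq> X" "C \<noteq> {}" "C \<noteq> X" "\<not> (\<exists>a\<in>C. \<exists>b\<in>X - C. E a b)"
    have "p \<in> C \<or> q \<in> C" by (rule touch) (use C X in blast)+
    moreover have "p \<in> X - C \<or> q \<in> X - C" by (rule touch) (use C X adj_sym in blast)+
    moreover have "p \<in> S - {v} - X \<or> q \<in> S - {v} - X" by (rule touch) (use C X adj_sym in blast)+
    ultimately show False using C by blast
  qed
  have A: "conn A0" using A0 by (intro cn) auto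
  have "\<forall>a\<in>B0. \<forall>b\<in>S - {v} - B0. \<not> E a b" using A0 adj_sym unfolding B0_def by blast
  moreover have "B0 \<subseteq> S - {v}" "B0 \<noteq> S - {v}" using A0 unfolding B0_def by auto
  ultimately have B: "conn B0" by (intro cn) auto
  have "p \<in> A0 \<or> q \<in> A0" using A0 by (intro touch) auto
  moreover have "p \<in> B0 \<or> q \<in> B0"
    by (rule touch) (use A0 adj_sym in \<open>unfold B0_def, blast+\<close>)
  ultimately consider "p \<in> A0" "q \<in> B0" | "p \<in> B0" "q \<in> A0" by (auto simp: B0_def)
  then show ?thesis
  proof cases
    case 1
    show ?thesis by (rule exI[of _ A0], rule exI[of _ B0]) (use 1 A0 A B in \<open>auto simp: B0_def\<close>)
  next
    case 2
    show ?thesis by (rule exI[of _ B0], rule exI[of _ A0]) (use 2 A0 A B adj_sym in \<open>unfold B0_def, blast\<close>)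
  qed
qed

section \<open>Good colourings\<close>

text \<open>The last conjunct keeps a vertex \<open>w2\<close> from having neighbours of both colours 6 and 7, which
  would make both unavailable for \<open>w1\<close>.\<close>

definition good :: "'a set \<Rightarrow> 'a \<Rightarrow> ('a \<Rightarrow> nat) \<Rightarrow> bool" where
  "good S z f \<longleftrightarrow> valid S f \<and>
     (\<forall>y\<in>S. \<forall>b. E y b \<longrightarrow> b \<notin> S \<longrightarrow> y = z \<or> rad (f y) = 1) \<and>
     rad (f z) \<noteq> 3 \<and>
     (rad (f z) = 2 \<longrightarrow> (\<exists>a\<in>S. \<exists>b\<in>S. a \<noteq> b \<and> E z a \<and> E z b)) \<and>
     (\<forall>a\<in>S. \<forall>b\<in>S. E z a \<longrightarrow> E z b \<longrightarrow> rad (f a) = 3 \<longrightarrow> rad (f b) = 3 \<longrightarrow> a = b)"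

lemma goodI:
  assumes "valid S f" "\<And>y b. y \<in> S \<Longrightarrow> y \<noteq> z \<Longrightarrow> E y b \<Longrightarrow> b \<notin> S \<Longrightarrow> rad (f y) = 1"
    and "rad (f z) \<noteq> 3"
    and "rad (f z) = 2 \<Longrightarrow> \<exists>a\<in>S. \<exists>b\<in>S. a \<noteq> b \<and> E z a \<and> E z b"
    and "\<And>a b. a \<in> S \<Longrightarrow> b \<in> S \<Longrightarrow> E z a \<Longrightarrow> E z b \<Longrightarrow> rad (f a) = 3 \<Longrightarrow> rad (f b) = 3 \<Longrightarrow> a = b"
  shows "good S z f"
  using assms unfolding good_def by blast

lemma good_valid: "good S z f \<Longrightarrow> valid S f"
  unfolding good_def by blast

lemma good_boundary: "good S z f \<Longrightarrow> y \<in> S \<Longrightarrow> E y b \<Longrightarrow> b \<notin> S \<Longrightarrow> y \<noteq> z \<Longrightarrow> rad (f y) = 1"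
  unfolding good_def by blast

lemma good_root: "good S z f \<Longrightarrow> z \<in> S \<Longrightarrow> rad (f z) = 1 \<or> rad (f z) = 2"
  unfolding good_def using valid_rad by blast

text \<open>This is the purpose of the fourth conjunct of \<open>good\<close>: a root of class 2 has
  two neighbours in \<open>S\<close>, so \<open>v\<close> is its only neighbour outside. Once
  \<open>v\<close> is added, the root is no boundary vertex any more.\<close>

lemma good_inner:
  assumes "good S z f" "z \<in> S" "E z v" "v \<notin> S" "y \<in> S" "E y b" "b \<notin> insert v S"
  shows "rad (f y) = 1"
proof (cases "y = z")
  case True
  have "rad (f z) \<noteq> 2"
  proof
    assume "rad (f z) = 2"
    then obtain p q where "p \<in> S" "q \<in> S" "p \<noteq> q" "E z p" "E z q"
      using assms(1) unfolding good_def by blast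
    then show False using nbr_cases[of z p q v b] assms True by auto
  qed
  then show ?thesis using good_root assms True by blast
next
  case False
  then show ?thesis using good_boundary assms by blast
qed

lemma good_perm:
  assumes "good S z f" "\<And>c. rad (p c) = rad c" "\<And>c d. p c = p d \<Longrightarrow> c = d"
  shows "good S z (p \<circ> f)"
proof -
  have r: "p c \<in> {2..7}" if "c \<in> {2..7}" for c
    using rad_cases[OF that] rad_range assms(2) by metis
  have "valid S (p \<circ> f)"
    using assms(1) r assms(2,3) unfolding good_def valid_def by (metis comp_apply)
  then show ?thesis
    using assms(1,2) unfolding good_def comp_apply by auto
qed

text \<open>Exchanging the two colours of the class of \<open>f z\<close> on all of \<open>S\<close>
  preserves classes and equality of colours, and \<open>good\<close> sees nothing else.\<close>

lemma good_recolor_root: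
  assumes "good S z f" "rad d = rad (f z)" "rad d = 1 \<or> rad d = 2"
  shows "\<exists>g. good S z g \<and> g z = d"
proof (cases "d = f z")
  case True
  then show ?thesis using assms(1) by blast
next
  case neq: False
  define p where "p c = (if rad c = rad d then (if rad d = 1 then 5 - c else 9 - c) else c)" for c
  have rp: "rad (p c) = rad c" for c
    using assms(3) rad_opp(1)[of c] rad_opp2(1)[of c] unfolding p_def by auto
  have "c = c'" if eq: "p c = p c'" for c c'
  proof (cases "rad c = rad d")
    case True
    moreover from this have "rad c' = rad d" using rp[of c] rp[of c'] eq by simp
    ultimately show ?thesis
      using eq assms(3) unfolding p_def rad_1_iff rad_2_iff
      by (elim disjE) (simp_all add: rad_1_iff rad_2_iff del: One_nat_def, arith+)
  next
    case False
    moreover from this have "rad c' \<noteq> rad d" using rp[of c] rp[of c'] eq by simp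
    ultimately show ?thesis using eq unfolding p_def by simp
  qed
  with rp have "good S z (p \<circ> f)" by (intro good_perm[OF assms(1)])
  moreover have "p (f z) = d"
    using assms(2,3) neq rad_opp(4)[of "f z" d] rad_opp2(4)[of "f z" d] unfolding p_def by auto
  ultimately show ?thesis by auto
qed

definition saturated :: "'a set \<Rightarrow> ('a \<Rightarrow> nat) \<Rightarrow> bool" where
  "saturated S f \<longleftrightarrow> (\<forall>a\<in>S. rad (f a) \<noteq> 1 \<longrightarrow> (\<forall>c. rad c = 1 \<longrightarrow> (\<exists>b\<in>S. E a b \<and> f b = c)))"

text \<open>A good colouring with the most vertices of class 1 is saturated: otherwise one more
  vertex could be moved to class 1, and such a change preserves every conjunct of
  \<open>good\<close>.\<close>

lemma good_saturate:
  assumes "finite S" "z \<in> S" "good S z f"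
  shows "\<exists>f. good S z f \<and> saturated S f"
proof -
  define m where "m f = card {a\<in>S. rad (f a) = 1}" for f :: "'a \<Rightarrow> nat"
  have "m g < Suc (card S)" for g
    unfolding m_def less_Suc_eq_le using assms(1) by (intro card_mono) auto
  then have "\<exists>f. good S z f \<and> (\<forall>g. good S z g \<longrightarrow> m g \<le> m f)"
    using assms(3) by (intro ex_has_greatest_nat[where f = m]) auto
  then obtain f where f: "good S z f" and max: "\<And>g. good S z g \<Longrightarrow> m g \<le> m f"
    by blast
  have "saturated S f"
    unfolding saturated_def
  proof (intro ballI allI impI, rule ccontr)
    fix a c assume a: "a \<in> S" "rad (f a) \<noteq> 1" and c: "rad c = 1" and no: "\<not> (\<exists>b\<in>S. E a b \<and> f b = c)"
    define g where "g = f(a := c)"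
    have "valid S g"
      unfolding g_def using no c good_valid[OF f] by (intro valid_upd1) (auto intro: valid_mono)
    then have "good S z g"
      using f c unfolding good_def g_def by auto
    moreover have "m f < m g"
      unfolding m_def g_def using a c assms(1) by (intro psubset_card_mono) auto
    ultimately show False using max[of g] by simp
  qed
  with f show ?thesis by blast
qed

section \<open>Gluing colourings of separated parts\<close>

text \<open>A common neighbour of the two parts lies outside both. For class 2 the conflicting
  vertices are therefore boundary vertices, hence the two roots. A vertex of class 3 is never on the
  boundary, so a path of length 3 would have its middle edge between \<open>A\<close> and
  \<open>B\<close>.\<close>

lemma valid_combine:
  assumes f: "good A za f" and g: "good B zb g"
    and sep: "A \<inter> B = {}" "\<And>a b. a \<in> A \<Longrightarrow> b \<in> B \<Longrightarrow> \<not> E a b"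
    and roots: "rad (f za) = 2 \<Longrightarrow> f za \<noteq> g zb"
  shows "valid (A \<union> B) (\<lambda>a. if a \<in> A then f a else g a)"
proof -
  let ?h = "\<lambda>a. if a \<in> A then f a else g a"
  have cross: "\<not> near (rad (f a)) a b" if ab: "a \<in> A" "b \<in> B" and eq: "f a = g b" for a b
  proof
    assume n: "near (rad (f a)) a b"
    have ab': "a \<noteq> b" "\<not> E a b" using ab sep by auto
    have out: "c \<notin> A \<and> c \<notin> B" if "E a c" "E c b" for c
      using that ab sep(2) adj_sym by blast
    consider "rad (f a) = 1" | "rad (f a) = 2" | "rad (f a) = 3"
      using valid_rad good_valid[OF f] ab(1) by blast
    then show False
    proof cases
      case 1
      with n ab' show False by (metis near_1)
    next
      case 2
      with n ab' obtain c where c: "E a c" "E c b" by (metis near_2)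
      have "a = za" using good_boundary[OF f ab(1) c(1)] out c 2 by auto
      moreover have "b = zb" using good_boundary[OF g ab(2), of c] out c adj_sym 2 eq by auto
      ultimately show False using roots 2 eq by auto
    next
      case 3
      have a: "a \<noteq> za" and b: "b \<noteq> zb" using f g 3 eq unfolding good_def by auto
      have a': "c \<in> A" if "E a c" for c using good_boundary[OF f ab(1) that] a 3 by auto
      have b': "c \<in> B" if "E c b" for c using good_boundary[OF g ab(2) adj_sym[OF that]] b 3 eq by auto
      show False using n ab' out a' b' sep(2) 3 by (metis near_3)
    qed
  qed
  show ?thesis
    unfolding valid_def
  proof (intro conjI ballI impI)
    fix a assume "a \<in> A \<union> B"
    then show "?h a \<in> {2..7}" using valid_range[OF good_valid[OF f]] valid_range[OF good_valid[OF g]] by auto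
  next
    fix a b assume ab: "a \<in> A \<union> B" "b \<in> A \<union> B" "a \<noteq> b" "?h a = ?h b"
    consider "a \<in> A" "b \<in> A" | "a \<notin> A" "b \<notin> A" | "a \<in> A" "b \<notin> A" | "a \<notin> A" "b \<in> A" by blast
    then show "\<not> near (rad (?h a)) a b"
    proof cases
      case 1 then show ?thesis using ab validD[OF good_valid[OF f], of a b] by auto
    next
      case 2 then show ?thesis using ab validD[OF good_valid[OF g], of a b] by auto
    next
      case 3 then show ?thesis using ab cross[of a b] by auto
    next
      case 4 then show ?thesis using ab cross[of b a] near_sym by auto
    qed
  qed
qed

lemma extend_leaf:
  assumes S: "v \<in> S" "w \<in> S" "E v w" and leaf: "\<And>a. a \<in> S \<Longrightarrow> E v a \<Longrightarrow> a = w"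
    and f: "good (S - {v}) w f"
  shows "\<exists>g. good S v g"
proof -
  have w: "w \<in> S - {v}" using S adj_irrefl by auto
  obtain c where c: "rad c = 1" "f w \<noteq> c" 
  proof (cases "f w = 2")
    case True
    then show ?thesis using that[of 3] by simp
  next
    case False
    then show ?thesis using that[of 2] by simp
  qed
  have "good S v (f(v := c))"
  proof (rule goodI)
    show "valid S (f(v := c))"
      using leaf c by (intro valid_upd1 good_valid[OF f]) auto
  next
    fix y b assume y: "y \<in> S" "y \<noteq> v" "E y b" "b \<notin> S"
    then have "rad (f y) = 1"
      using good_inner[OF f w adj_sym[OF S(3)], of y b] S(1) by auto
    then show "rad ((f(v := c)) y) = 1" using y by simp
  qed (use c leaf in auto)
  then show ?thesis by blast
qed

lemma extend_cut:
  assumes v: "v \<in> S" and AB: "A \<union> B = S - {v}" "A \<inter> B = {}" "\<And>a b. a \<in> A \<Longrightarrow> b \<in> B \<Longrightarrow> \<not> E a b"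
    and w: "w1 \<in> A" "w2 \<in> B" "E v w1" "E v w2" "\<And>a. a \<in> S \<Longrightarrow> E v a \<Longrightarrow> a = w1 \<or> a = w2"
    and f: "good A w1 f" and g0: "good B w2 g0"
  shows "\<exists>h. good S v h"
proof -
  \<comment> \<open>The colours of \<open>B\<close> are permuted so that the roots agree if both
    have class 1, leaving one of 2, 3 for \<open>v\<close>, and differ if both have class 2, as
    \<open>valid_combine\<close> demands. For different classes at most one of 2, 3 is taken
    anyway.\<close>
  obtain g where g: "good B w2 g" and eq: "rad (f w1) = rad (g w2) \<Longrightarrow> g w2 = (if rad (f w1) = 1 then f w1 else 9 - f w1)"
  proof (cases "rad (f w1) = rad (g0 w2)")
    case True
    then have "\<exists>g. good B w2 g \<and> g w2 = (if rad (f w1) = 1 then f w1 else 9 - f w1)"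
      using good_root[OF f w(1)] rad_opp2(1)[of "f w1"] by (intro good_recolor_root[OF g0]) auto
    then show ?thesis using that by blast
  next
    case False
    then show ?thesis using that g0 by blast
  qed
  define h where "h a = (if a \<in> A then f a else g a)" for a
  have h: "valid (S - {v}) h"
    unfolding h_def AB(1)[symmetric]
    using eq rad_opp2(2)[of "f w1"] by (intro valid_combine[OF f g AB(2,3)]) auto
  have hw: "h w1 = f w1" "h w2 = g w2" using w(1,2) AB(2) by (auto simp: h_def)
  have rr: "rad (f w1) = 1 \<or> rad (f w1) = 2" "rad (g w2) = 1 \<or> rad (g w2) = 2"
    using good_root f g w(1,2) by auto
  obtain c where c: "rad c = 1" "h w1 \<noteq> c" "h w2 \<noteq> c"
  proof -
    have "h w1 \<noteq> 2 \<and> h w2 \<noteq> 2 \<or> h w1 \<noteq> 3 \<and> h w2 \<noteq> 3"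
      using eq unfolding hw by fastforce
    then show ?thesis using that[of 2] that[of 3] by auto
  qed
  have "good S v (h(v := c))"
  proof (rule goodI)
    show "valid S (h(v := c))"
      by (rule valid_upd1[OF h c(1)]) (use w(5) c in blast)
  next
    fix y b assume y: "y \<in> S" "y \<noteq> v" "E y b" "b \<notin> S"
    have v': "v \<notin> A" "v \<notin> B" using AB(1) by auto
    have "rad (h y) = 1"
    proof (cases "y \<in> A")
      case True
      then show ?thesis
        using good_inner[OF f w(1) adj_sym[OF w(3)], of y b] y AB(1) v' v by (auto simp: h_def)
    next
      case False
      then show ?thesis
        using good_inner[OF g w(2) adj_sym[OF w(4)], of y b] y AB(1) v' v by (auto simp: h_def)
    qed
    then show "rad ((h(v := c)) y) = 1" using y by simp
  next
    fix a b assume a: "a \<in> S" "E v a" "rad ((h(v := c)) a) = 3"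
    have "a = w1 \<or> a = w2" using a w(5) by auto
    then have False using a rr c(1) hw by (auto split: if_splits)
    then show "a = b" ..
  qed (use c in auto)
  then show ?thesis by blast
qed

end

section \<open>Extending a colouring by two adjacent vertices\<close>

locale pending_vertex = subcubic_adjacency +
  fixes S :: "'a set" and v w1 w2 u :: 'a
  assumes S: "v \<in> S" "w1 \<in> S" "w2 \<in> S" "u \<notin> S"
    and w1_neq_w2: "w1 \<noteq> w2"
    and adj_v: "E v w1" "E v w2" "E v u"
begin

abbreviation S0 :: "'a set" where "S0 \<equiv> S - {v, w1}"

lemma nbr_v: "E v b \<Longrightarrow> b = w1 \<or> b = w2 \<or> b = u"
  using nbr_cases[of v w1 w2 u b] adj_v w1_neq_w2 S by auto

lemma w2_S0: "w2 \<in> S0"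
  using S w1_neq_w2 adj_v adj_irrefl by auto

lemma v_neq_w1: "v \<noteq> w1"
  using adj_v(1) adj_irrefl by auto

text \<open>What \<open>finish\<close> needs of a colouring of \<open>S0\<close>: only edges leaving
  \<open>S\<close> matter, so vertices whose outside neighbours are just \<open>v\<close> and
  \<open>w1\<close> are not restricted.\<close>

definition partial :: "('a \<Rightarrow> nat) \<Rightarrow> bool" where
  "partial f \<longleftrightarrow> valid S0 f \<and> (\<forall>y\<in>S0. \<forall>b. E y b \<longrightarrow> b \<notin> S \<longrightarrow> rad (f y) = 1) \<and> rad (f w2) \<noteq> 3"

lemma partial_w2: "partial f \<Longrightarrow> rad (f w2) = 1 \<or> rad (f w2) = 2"
  unfolding partial_def using valid_rad[of S0 f w2] w2_S0 by auto

text \<open>The new root \<open>v\<close> may have class 2, as \<open>w1\<close> and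
  \<open>w2\<close> are its two neighbours in \<open>S\<close>. At most one of them has class 3,
  because \<open>w2\<close> has not.\<close>

lemma finish:
  assumes f: "partial f" and g: "valid S (f(w1 := c, v := d))"
    and d: "rad d \<noteq> 3" and c: "rad c = 1 \<or> (\<forall>b. E w1 b \<longrightarrow> b \<in> S)"
  shows "\<exists>g. good S v g"
proof -
  have "good S v (f(w1 := c, v := d))"
  proof (rule goodI)
    fix y b assume y: "y \<in> S" "y \<noteq> v" "E y b" "b \<notin> S"
    show "rad ((f(w1 := c, v := d)) y) = 1"
    proof (cases "y = w1")
      case True
      then show ?thesis using y c by auto
    next
      case False
      then show ?thesis using f y unfolding partial_def by auto
    qed
  next
    show "\<exists>a\<in>S. \<exists>b\<in>S. a \<noteq> b \<and> E v a \<and> E v b"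
      using S w1_neq_w2 adj_v by blast
  next
    fix a b assume *: "a \<in> S" "b \<in> S" "E v a" "E v b"
      "rad ((f(w1 := c, v := d)) a) = 3" "rad ((f(w1 := c, v := d)) b) = 3"
    have "rad ((f(w1 := c, v := d)) w2) \<noteq> 3"
      using f w2_S0 unfolding partial_def by auto
    then show "a = b" using * nbr_v S by metis
  qed (use g d in auto)
  then show ?thesis by blast
qed

lemma finish_one_one:
  assumes f: "partial f" and c: "rad c = 1" "\<And>a. a \<in> S0 \<Longrightarrow> E w1 a \<Longrightarrow> f a \<noteq> c" and w: "f w2 \<noteq> 5 - c"
  shows "\<exists>g. good S v g"
proof (rule finish[OF f, of c "5 - c"])
  have eq: "S - {v} - {w1} = S0" by auto
  have "valid (S - {v}) (f(w1 := c))"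
    by (rule valid_upd1) (use f c eq adj_irrefl in \<open>auto simp: partial_def\<close>)
  then show "valid S (f(w1 := c, v := 5 - c))"
  proof (rule valid_upd1)
    fix b assume "b \<in> S" "E v b"
    then have "b = w1 \<or> b = w2" using nbr_v S by auto
    then show "(f(w1 := c)) b \<noteq> 5 - c" using w rad_opp(2)[OF c(1)] w1_neq_w2 by auto
  qed (use c rad_opp in auto)
  show "rad (5 - c) \<noteq> 3" using rad_opp(1)[OF c(1)] by simp
qed (use c in auto)

lemma finish_one_two:
  assumes f: "partial f" and c: "rad c = 1" "\<And>a. a \<in> S0 \<Longrightarrow> E w1 a \<Longrightarrow> f a \<noteq> c" and w: "f w2 \<noteq> d"
    and d: "rad d = 2" "\<And>a. a \<in> S0 \<Longrightarrow> E w1 a \<or> E w2 a \<Longrightarrow> f a \<noteq> d"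
  shows "\<exists>g. good S v g"
proof (rule finish[OF f, of c d])
  have eq: "S - {v} - {w1} = S0" by auto
  have "valid (S - {v}) (f(w1 := c))"
    by (rule valid_upd1) (use f c eq adj_irrefl in \<open>auto simp: partial_def\<close>)
  then show "valid S (f(w1 := c, v := d))"
  proof (rule valid_upd2)
    fix b assume b: "b \<in> S" "b \<noteq> v" "near 2 v b"
    show "(f(w1 := c)) b \<noteq> d"
    proof (cases "b = w1")
      case True
      then show ?thesis using c d by auto
    next
      case False
      then have b0: "b \<in> S0" using b by auto
      \<comment> \<open>Distance 2 from \<open>v\<close> is reached through \<open>w1\<close>,
        \<open>w2\<close> or \<open>u\<close>; the vertices of \<open>S0\<close> next to
        \<open>u\<close> have class 1.\<close>
      then consider "b = w2" | "E w1 b \<or> E w2 b" | "E u b"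
        using b S nbr_v unfolding near_2 by blast
      then have "f b \<noteq> d"
      proof cases
        case 3
        then have "rad (f b) = 1" using f b0 S adj_sym unfolding partial_def by blast
        then show ?thesis using d by auto
      qed (use w d b0 in auto)
      then show ?thesis using False by simp
    qed
  qed (use d in auto)
  show "rad d \<noteq> 3" using d by simp
qed (use c in auto)

lemma finish_any_one:
  assumes f: "partial f" and c: "rad c = 2 \<or> rad c = 3" "\<And>a. a \<in> S0 \<Longrightarrow> near (rad c) w1 a \<Longrightarrow> f a \<noteq> c"
    and int: "\<And>b. E w1 b \<Longrightarrow> b \<in> S"
    and d: "rad d = 1" "f w2 \<noteq> d"
  shows "\<exists>g. good S v g"
proof (rule finish[OF f, of c d])
  have eq: "S - {v} - {w1} = S0" by auto
  have "valid (S - {v}) (f(w1 := c))"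
  proof (rule valid_upd)
    show "c \<in> {2..7}" using c(1) rad_range by blast
    show "\<not> near (rad c) w1 b" if "b \<in> S - {v}" "b \<noteq> w1" "f b = c" for b
      using c(2)[of b] that by auto
  qed (use f eq in \<open>auto simp: partial_def\<close>)
  then show "valid S (f(w1 := c, v := d))"
  proof (rule valid_upd1)
    fix b assume "b \<in> S" "E v b"
    then have "b = w1 \<or> b = w2" using nbr_v S by auto
    then show "(f(w1 := c)) b \<noteq> d" using d c w1_neq_w2 by auto
  qed (use d in auto)
qed (use int d in auto)

text \<open>A Kempe change: \<open>F\<close> is a union of components of the subgraph of
  \<open>S0\<close> formed by the colours 2 and 3.\<close>

lemma partial_flip:
  assumes f: "partial f" and F: "\<And>a. a \<in> F \<Longrightarrow> a \<in> S0 \<and> rad (f a) = 1"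
    and closed: "\<And>a b. a \<in> F \<Longrightarrow> b \<in> S0 \<Longrightarrow> b \<notin> F \<Longrightarrow> E a b \<Longrightarrow> rad (f b) \<noteq> 1"
  shows "partial (\<lambda>a. if a \<in> F then 5 - f a else f a)"
proof -
  let ?g = "\<lambda>a. if a \<in> F then 5 - f a else f a"
  have r: "rad (?g a) = rad (f a)" for a using F rad_opp(1) by auto
  have v: "valid S0 f" using f by (simp add: partial_def)
  have "valid S0 ?g"
    unfolding valid_def
  proof (intro conjI ballI impI)
    fix a assume "a \<in> S0"
    then show "?g a \<in> {2..7}"
      using valid_range[OF v] F rad_opp(1) rad_range(1) by (cases "a \<in> F") auto
  next
    fix a b assume ab: "a \<in> S0" "b \<in> S0" "a \<noteq> b" "?g a = ?g b"
    show "\<not> near (rad (?g a)) a b"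
    proof (cases "a \<in> F \<longleftrightarrow> b \<in> F")
      case True
      then have "f a = f b"
        using ab(4) F rad_opp(3)[of "f a"] rad_opp(3)[of "f b"] by (metis (no_types, lifting))
      then show ?thesis using validD[OF v ab(1-3)] r by auto
    next
      case False
      then have 1: "rad (?g a) = 1" using ab(4) r F by metis
      then have "rad (f a) = 1" "rad (f b) = 1" using r ab(4) by metis+
      then have "\<not> E a b" using False closed[of a b] closed[of b a] ab adj_sym by blast
      then show ?thesis using 1 ab(3) by (simp add: near_1[simplified])
    qed
  qed
  then show ?thesis using f r unfolding partial_def by auto
qed

text \<open>\<open>w1\<close> receives \<open>c\<close>. The three alternatives give
  \<open>v\<close> the colour \<open>5 - c\<close>, a colour \<open>d\<close> of class 2, or
  \<open>5 - c\<close> after \<open>w2\<close> has switched to \<open>c\<close>.\<close>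

lemma extend_uncolored_pair:
  assumes f: "partial f" and c: "rad c = 1" "\<And>a. a \<in> S0 \<Longrightarrow> E w1 a \<Longrightarrow> f a \<noteq> c"
    and alt: "f w2 \<noteq> 5 - c \<or> (\<exists>d. rad d = 2 \<and> (\<forall>a\<in>S0. E w1 a \<or> E w2 a \<longrightarrow> f a \<noteq> d)) \<or>
      (\<not> E w1 w2 \<and> (\<forall>a\<in>S0. E w2 a \<longrightarrow> f a \<noteq> c))"
  shows "\<exists>g. good S v g"
proof (cases "f w2 \<noteq> 5 - c")
  case True
  then show ?thesis using finish_one_one f c by blast
next
  case False
  then have w2: "f w2 = 5 - c" "rad (f w2) = 1" using rad_opp(1)[OF c(1)] by auto
  from False alt consider d where "rad d = 2" "\<forall>a\<in>S0. E w1 a \<or> E w2 a \<longrightarrow> f a \<noteq> d" 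
    | "\<not> E w1 w2" "\<forall>a\<in>S0. E w2 a \<longrightarrow> f a \<noteq> c" by blast
  then show ?thesis
  proof cases
    case 1
    then show ?thesis using finish_one_two[OF f c] w2 by (metis numeral_eq_one_iff semiring_norm(85))
  next
    case 2
    let ?g = "f(w2 := c)"
    have "valid S0 ?g"
      using 2(2) c(1) f by (intro valid_upd1) (auto simp: partial_def intro: valid_mono)
    then have "partial ?g" using f c(1) unfolding partial_def by auto
    moreover have "?g w2 \<noteq> 5 - c" using rad_opp(2)[OF c(1)] by simp
    moreover have "\<And>a. a \<in> S0 \<Longrightarrow> E w1 a \<Longrightarrow> ?g a \<noteq> c" using 2(1) c(2) by auto
    ultimately show ?thesis using finish_one_one[OF _ c(1)] by blast
  qed
qed

lemma w2_two_nbrs: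
  assumes "p \<in> S0" "q \<in> S0" "E w2 p" "E w2 q" "p \<noteq> q"
  shows "\<not> E w1 w2" "E w2 b \<Longrightarrow> b = v \<or> b = p \<or> b = q"
  using assms nbr_cases[of w2 v p q] adj_sym[OF adj_v(2)] v_neq_w1 adj_sym by blast+

text \<open>If the first two alternatives fail, the colours 4 and 5 both occur next to
  \<open>w2\<close>. Together with \<open>v\<close> this exhausts its degree, so \<open>w2\<close>
  is not adjacent to \<open>w1\<close>, sees no \<open>c\<close>, and the third alternative
  applies.\<close>

lemma extend_uncolored_pair_one:
  assumes f: "partial f" and c: "rad c = 1" "\<And>a. a \<in> S0 \<Longrightarrow> E w1 a \<Longrightarrow> f a \<noteq> c \<and> (rad (f a) = 1 \<or> a = w2)"
  shows "\<exists>g. good S v g"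
proof (rule extend_uncolored_pair[OF f c(1)], use c in blast, rule ccontr)
  assume no: "\<not> (f w2 \<noteq> 5 - c \<or> (\<exists>d. rad d = 2 \<and> (\<forall>a\<in>S0. E w1 a \<or> E w2 a \<longrightarrow> f a \<noteq> d)) \<or>
      (\<not> E w1 w2 \<and> (\<forall>a\<in>S0. E w2 a \<longrightarrow> f a \<noteq> c)))"
  have w2: "rad (f w2) = 1" using no rad_opp(1)[OF c(1)] by auto
  have ex: "\<exists>a\<in>S0. E w2 a \<and> f a = d" if d: "rad d = 2" for d
  proof -
    obtain a where a: "a \<in> S0" "E w1 a \<or> E w2 a" "f a = d" using no d by blast
    then have "\<not> E w1 a" using c(2) w2 d by fastforce
    with a show ?thesis by blast
  qed
  obtain p q where pq: "p \<in> S0" "q \<in> S0" "E w2 p" "E w2 q" "f p = 4" "f q = 5"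
    using ex[of 4] ex[of 5] by auto
  then have "p \<noteq> q" by auto
  note * = w2_two_nbrs[OF pq(1-4) this]
  have "c \<noteq> 4" "c \<noteq> 5" using c(1) by auto
  then show False using no * pq by blast
qed

end

section \<open>The critical case\<close>

text \<open>A hypothetical counterexample, to be refuted in \<open>never_stuck\<close>:
  \<open>x\<close> and \<open>y\<close> block both colours of class 1 at \<open>w1\<close>. Facts
  are proved for \<open>x\<close> and transferred to \<open>y\<close> by
  \<open>stuck_swap\<close>.\<close>

locale stuck = pending_vertex +
  fixes x y :: 'a and f :: "'a \<Rightarrow> nat"
  assumes xy: "x \<in> S0" "y \<in> S0" "x \<noteq> y" "E w1 x" "E w1 y"
    and good_f: "good S0 w2 f" and sat: "saturated S0 f"
    and one_xy: "rad (f x) = 1" "rad (f y) = 1" and neq_xy: "f x \<noteq> f y"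
    and no_good: "\<not> (\<exists>g. good S v g)"
begin

lemma stuck_swap: "stuck E S v w1 w2 u y x f"
  using xy good_f sat one_xy neq_xy no_good by unfold_locales auto

lemma valid_f: "valid S0 f"
  using good_f good_valid by blast

lemma fy: "f y = 5 - f x"
  using rad_opp(4) one_xy neq_xy by auto

lemma one_cases: "rad c = 1 \<Longrightarrow> c = f x \<or> c = f y"
  using rad_opp(4)[of "f x" c] one_xy fy by auto

lemma nbr_w1: "E w1 b \<Longrightarrow> b = v \<or> b = x \<or> b = y"
  using nbr_cases[of w1 v x y b] adj_sym[OF adj_v(1)] xy by auto

lemma v_notin: "v \<notin> S0" "w1 \<notin> S0" by auto

lemma partial_f: "partial f"
proof -
  have "rad (f a) = 1" if "a \<in> S0" "E a b" "b \<notin> S" for a b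
    by (rule good_inner[OF good_f w2_S0 adj_sym[OF adj_v(2)], of a b]) (use that S in auto)
  moreover have "rad (f w2) \<noteq> 3" using good_f unfolding good_def by blast
  ultimately show ?thesis using valid_f unfolding partial_def by blast
qed

lemma boundary_one: "a \<in> S0 \<Longrightarrow> E a b \<Longrightarrow> b \<notin> S \<Longrightarrow> rad (f a) = 1"
  using partial_f unfolding partial_def by blast

section \<open>Hot vertices and Kempe changes at \<open>x\<close>\<close>

definition hot :: "'a \<Rightarrow> bool" where "hot a \<longleftrightarrow> a \<in> S0 \<and> rad (f a) \<noteq> 1"

lemma hot_S0: "hot a \<Longrightarrow> a \<in> S0" by (simp add: hot_def)

lemma hot_xy: "\<not> hot x" "\<not> hot y" using one_xy by (auto simp: hot_def)

lemma sat_hot: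
  assumes "hot r" obtains p q where "p \<in> S0" "q \<in> S0" "E r p" "E r q" "f p = f x" "f q = f y"
  using sat assms one_xy unfolding saturated_def hot_def by metis

lemma hot_nbrs_le: "E a p \<Longrightarrow> \<not> hot p \<Longrightarrow> card {s. E a s \<and> hot s} \<le> 2"
proof -
  assume "E a p" "\<not> hot p"
  then have "{s. E a s \<and> hot s} \<subset> {s. E a s}" by auto
  then have "card {s. E a s \<and> hot s} < card {s. E a s}" by (rule psubset_card_mono[OF finite_nbrs])
  then show ?thesis using card_nbrs[of a] by linarith
qed

lemma hot_nbr_unique:
  "E a p \<Longrightarrow> E a q \<Longrightarrow> p \<noteq> q \<Longrightarrow> \<not> hot p \<Longrightarrow> \<not> hot q \<Longrightarrow> E a s \<Longrightarrow> E a t \<Longrightarrow> hot s \<Longrightarrow> hot t \<Longrightarrow> s = t"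
  using nbr_cases[of a p q s t] by auto

text \<open>In other words, \<open>x\<close> and \<open>y\<close> lie in the same Kempe component:
  flipping a closed set with \<open>x\<close> but without \<open>y\<close> would free the old colour
  \<open>f x\<close> at \<open>w1\<close>.\<close>

lemma flipD:
  assumes F: "\<And>a. a \<in> F \<Longrightarrow> a \<in> S0 \<and> rad (f a) = 1" "x \<in> F"
    and closed: "\<And>a b. a \<in> F \<Longrightarrow> b \<in> S0 \<Longrightarrow> b \<notin> F \<Longrightarrow> E a b \<Longrightarrow> rad (f b) \<noteq> 1"
  shows "y \<in> F"
proof (rule ccontr)
  assume y: "y \<notin> F"
  let ?g = "\<lambda>a. if a \<in> F then 5 - f a else f a"
  have g: "?g x = f y" "?g y = f y" using F(2) y fy by auto
  have "partial ?g" by (rule partial_flip[OF partial_f F(1) closed])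
  moreover have "?g a \<noteq> f x \<and> (rad (?g a) = 1 \<or> a = w2)" if "a \<in> S0" "E w1 a" for a
  proof -
    have "a = x \<or> a = y" using nbr_w1[OF that(2)] that(1) by auto
    then show ?thesis using g one_xy neq_xy by auto
  qed
  ultimately show False using extend_uncolored_pair_one[of ?g "f x"] one_xy no_good by blast
qed

lemma nbr_one:
  assumes "a \<in> S0" "f a = f x" "E a b" "b \<in> S0" "rad (f b) = 1" shows "f b = f y"
  using one_cases[OF assms(5)] valid_adj[OF valid_f assms(1,4,3)] assms(2) by auto

lemma opp_nbr: obtains z where "z \<in> S0" "E x z" "f z = f y"
proof (rule ccontr)
  assume no: "\<not> thesis"
  \<comment> \<open>Without such a neighbour, \<open>{x}\<close> would be a Kempe component of its
    own.\<close>
  have "y \<in> {x}"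
  proof (rule flipD)
    show "rad (f b) \<noteq> 1" if "a \<in> {x}" "b \<in> S0" "b \<notin> {x}" "E a b" for a b
      using that no nbr_one[of x b] xy \<open>\<And>z. z \<in> S0 \<Longrightarrow> E x z \<Longrightarrow> f z = f y \<Longrightarrow> thesis\<close> by auto
  qed (use xy one_xy in auto)
  then show False using xy by auto
qed

text \<open>If this failed, exchanging the colours of \<open>x\<close> and \<open>z\<close> would make \<open>f x = f y\<close>.\<close>

lemma hot_beyond_unique:
  assumes z: "z \<in> S0" "E x z" "f z = f y" and uniq: "\<And>z'. z' \<in> S0 \<Longrightarrow> E x z' \<Longrightarrow> f z' = f y \<Longrightarrow> z' = z"
    and st: "E z s" "E z t" "hot s" "hot t"
  shows "s = t"
proof (cases "z = y")
  case True
  then have "E z x" "E z w1" "x \<noteq> w1" "\<not> hot w1"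
    using z(2) adj_sym xy by (blast, blast, auto simp: hot_def)
  then show ?thesis
    using hot_nbr_unique st hot_xy(1) by blast
next
  case False
  have "\<exists>p\<in>S0. p \<noteq> x \<and> E z p \<and> rad (f p) = 1"
  proof (rule ccontr)
    assume no: "\<not> ?thesis"
    have "y \<in> {x, z}"
    proof (rule flipD)
      show "rad (f b) \<noteq> 1" if "a \<in> {x, z}" "b \<in> S0" "b \<notin> {x, z}" "E a b" for a b
      proof (cases "a = x")
        case True
        then have "E x b" using that(4) by simp
        then show ?thesis using nbr_one[OF xy(1) refl \<open>E x b\<close> that(2)] uniq[OF that(2) \<open>E x b\<close>] that(3) by auto
      next
        case False
        then have "E z b" using that(1,4) by auto
        then show ?thesis using that(2,3) no by auto
      qed
      show "a \<in> S0 \<and> rad (f a) = 1" if "a \<in> {x, z}" for a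
      proof -
        have "rad (f z) = 1" using z(3) one_xy(2) by simp
        then show ?thesis using that z(1) xy(1) one_xy(1) by blast
      qed
    qed simp
    then show False using xy(3) False by blast
  qed
  then obtain p where "p \<in> S0" "x \<noteq> p" "E z p" "rad (f p) = 1" by blast
  moreover from this have "\<not> hot p" by (simp add: hot_def)
  moreover have "E z x" using z(2) by (rule adj_sym)
  ultimately show ?thesis
    using hot_nbr_unique st hot_xy(1) by blast
qed

text \<open>Each of \<open>z1\<close>, \<open>z2\<close> has the neighbour \<open>x\<close>, which
  is not hot, so at most two hot ones. One of them has a further neighbour that is not hot, hence
  only one hot one: \<open>w1\<close> if \<open>y\<close> is among them, and otherwise because
  \<open>{x, z1, z2}\<close> is no Kempe component.\<close>

lemma hot_beyond_card:
  assumes z: "z1 \<in> S0" "E x z1" "f z1 = f y" "z2 \<in> S0" "E x z2" "f z2 = f y" "z1 \<noteq> z2"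
  shows "finite {s. (E z1 s \<or> E z2 s) \<and> hot s} \<and> card {s. (E z1 s \<or> E z2 s) \<and> hot s} \<le> 3"
proof -
  let ?H = "\<lambda>z. {s. E z s \<and> hot s}"
  have nx: "\<And>b. E x b \<Longrightarrow> b = w1 \<or> b = z1 \<or> b = z2"
    using nbr_cases[of x w1 z1 z2] z adj_sym[OF xy(4)] by auto
  have fin: "finite (?H z)" for z using finite_nbrs[of z] by (rule rev_finite_subset) auto
  have le2: "card (?H z1) \<le> 2" "card (?H z2) \<le> 2"
    using hot_nbrs_le z adj_sym hot_xy by blast+
  have le1: "card (?H z) \<le> 1" if "E z p" "E z q" "p \<noteq> q" "\<not> hot p" "\<not> hot q" for z p q
  proof -
    have "\<forall>s\<in>?H z. \<forall>t\<in>?H z. s = t" using hot_nbr_unique[OF that] by blast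
    then show ?thesis using card_le_Suc0_iff_eq[OF fin] by auto
  qed
  have "\<exists>z\<in>{z1, z2}. \<exists>p. p \<noteq> x \<and> E z p \<and> \<not> hot p"
  proof (cases "y \<in> {z1, z2}")
    case True
    moreover have "E y w1" "w1 \<noteq> x" "\<not> hot w1" using xy adj_sym by (blast, auto simp: hot_def)
    ultimately show ?thesis by blast
  next
    case False
    show ?thesis
    proof (rule ccontr)
      assume no: "\<not> ?thesis"
      have "y \<in> {x, z1, z2}"
      proof (rule flipD)
        show "rad (f b) \<noteq> 1" if "a \<in> {x, z1, z2}" "b \<in> S0" "b \<notin> {x, z1, z2}" "E a b" for a b
        proof -
          have "a \<noteq> x" using nx[of b] that(2-4) by auto
          then have "E z1 b \<or> E z2 b" using that(1,4) by auto
          then have "hot b" using no that(3) by blast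
          then show ?thesis by (simp add: hot_def)
        qed
        show "a \<in> S0 \<and> rad (f a) = 1" if "a \<in> {x, z1, z2}" for a
        proof -
          have "rad (f z1) = 1" "rad (f z2) = 1" using z(3,6) one_xy(2) by simp_all
          then show ?thesis using that z(1,4) xy(1) one_xy(1) by blast
        qed
      qed simp
      then show False using xy(3) False by blast
    qed
  qed
  then have "card (?H z1) \<le> 1 \<or> card (?H z2) \<le> 1"
    using le1 z adj_sym hot_xy(1) by blast
  moreover have "{s. (E z1 s \<or> E z2 s) \<and> hot s} = ?H z1 \<union> ?H z2" by auto
  ultimately show ?thesis
    using card_Un_le[of "?H z1" "?H z2"] le2 fin by auto
qed

text \<open>No hot vertex is reached from \<open>x\<close> through \<open>w1\<close>, whose
  neighbours are \<open>v\<close>, \<open>x\<close>, \<open>y\<close>, nor through a vertex outside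
  \<open>S\<close>, next to which all of \<open>S0\<close> has class 1. The only vertex of
  \<open>S0\<close> adjacent to \<open>v\<close> is \<open>w2\<close>, so \<open>v\<close> leads
  nowhere new either.\<close>

lemma near_2_hot:
  assumes "near 2 x a" "hot a" shows "E x a \<or> (\<exists>b\<in>S0. E x b \<and> E b a)"
proof -
  have "a \<noteq> x" using assms(2) hot_xy by blast
  then consider "E x a" | b where "E x b" "E b a" using assms(1) unfolding near_2 by blast
  then show ?thesis
  proof cases
    case (2 b)
    have "b \<noteq> w1" using 2 nbr_w1 assms(2) hot_xy v_notin hot_def by blast
    moreover have "b \<noteq> v"
    proof
      assume b: "b = v"
      have "x = w2" using b 2 nbr_v[of x] adj_sym xy(1) S(4) by blast
      moreover have "a = w2" using b 2(2) nbr_v[of a] assms(2) S(4) unfolding hot_def by blast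
      ultimately show False using \<open>a \<noteq> x\<close> by simp
    qed
    moreover have "b \<in> S" using boundary_one[of a b] adj_sym[OF 2(2)] assms(2) unfolding hot_def by blast
    ultimately show ?thesis using 2 by blast
  qed blast
qed

text \<open>When \<open>x\<close> is recoloured with \<open>c\<close>, a neighbour of \<open>x\<close> of class 2 or 3 may be set free and take
  over the old colour of \<open>x\<close>.\<close>

definition movable :: "nat \<Rightarrow> bool" where
  "movable c \<longleftrightarrow> (\<exists>g. valid S0 g \<and> g x = c \<and> (\<forall>a. a \<noteq> x \<longrightarrow> g a \<noteq> f a \<longrightarrow> hot a \<and> E x a \<and> g a = f x))"

lemma movableI:
  assumes "valid S0 g" "g x = c" "\<And>a. a \<noteq> x \<Longrightarrow> g a \<noteq> f a \<Longrightarrow> hot a \<and> E x a \<and> g a = f x"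
  shows "movable c"
  using assms unfolding movable_def by blast

lemma movable_direct:
  assumes c: "rad c = 2" and free: "\<And>a. hot a \<Longrightarrow> near 2 x a \<Longrightarrow> f a \<noteq> c"
  shows "movable c"
proof (rule movableI)
  have "valid (S0 - {x}) f" using valid_f by (rule valid_mono) blast
  then show "valid S0 (f(x := c))"
  proof (rule valid_upd2[OF _ c])
    fix b assume b: "b \<in> S0" "b \<noteq> x" "near 2 x b"
    show "f b \<noteq> c"
    proof
      assume "f b = c"
      with b(1) c have "hot b" by (simp add: hot_def)
      with free b(3) \<open>f b = c\<close> show False by blast
    qed
  qed
qed simp_all

text \<open>If \<open>x\<close> is the only neighbour of \<open>r\<close> coloured
  \<open>f x\<close>, then \<open>r\<close> can take this colour when \<open>x\<close> gives it up,
  and so no longer blocks \<open>c\<close>.\<close>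

lemma movable_release:
  assumes c: "rad c = 2" and r: "hot r" "E x r" and rel: "\<And>t. t \<in> S0 \<Longrightarrow> E r t \<Longrightarrow> t \<noteq> x \<Longrightarrow> f t \<noteq> f x"
    and free: "\<And>a. hot a \<Longrightarrow> a \<noteq> r \<Longrightarrow> near 2 x a \<Longrightarrow> f a \<noteq> c"
  shows "movable c"
proof (rule movableI)
  have rx: "r \<noteq> x" using r(1) hot_xy by blast
  have "valid (S0 - {x} - {r}) f" using valid_f by (rule valid_mono) blast
  then have "valid (S0 - {x}) (f(r := f x))"
    by (rule valid_upd1[OF _ one_xy(1)]) (use rel in blast)
  then show "valid S0 (f(r := f x, x := c))"
  proof (rule valid_upd2[OF _ c])
    fix b assume b: "b \<in> S0" "b \<noteq> x" "near 2 x b"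
    show "(f(r := f x)) b \<noteq> c"
    proof
      assume eq: "(f(r := f x)) b = c"
      then have "b \<noteq> r" using c one_xy by auto
      with eq have "f b = c" by simp
      with b(1) c have "hot b" by (simp add: hot_def)
      with free b(3) \<open>f b = c\<close> \<open>b \<noteq> r\<close> show False by blast
    qed
  qed
  show "hot a \<and> E x a \<and> (f(r := f x, x := c)) a = f x"
    if "a \<noteq> x" "(f(r := f x, x := c)) a \<noteq> f a" for a
    using that r by (auto split: if_splits)
qed simp

text \<open>\<open>w1\<close>, \<open>r\<close> and the vertex \<open>z\<close> from
  \<open>opp_nbr\<close> exhaust the degree of \<open>x\<close>; so \<open>z\<close> is unique and
  \<open>hot_beyond_unique\<close> applies to it.\<close>

lemma hot_nbr_x:
  assumes r: "hot r" "E x r"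
  obtains z where "z \<in> S0" "f z = f y" "\<And>b. E x b \<Longrightarrow> b = w1 \<or> b = r \<or> b = z"
    "\<And>s t. E z s \<Longrightarrow> E z t \<Longrightarrow> hot s \<Longrightarrow> hot t \<Longrightarrow> s = t"
proof -
  obtain z where z: "z \<in> S0" "E x z" "f z = f y" by (rule opp_nbr)
  have "r \<noteq> z" using r(1) z(3) one_xy by (auto simp: hot_def)
  then have nx: "b = w1 \<or> b = r \<or> b = z" if "E x b" for b
    using nbr_cases[of x w1 r z b] that z r adj_sym[OF xy(4)] hot_S0[OF r(1)] by auto
  then have "z' = z" if "z' \<in> S0" "E x z'" "f z' = f y" for z'
    using that r(1) v_notin one_xy unfolding hot_def by metis
  from that[OF z(1,3) nx] hot_beyond_unique[OF z this] show thesis by blast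
qed

text \<open>By saturation \<open>r\<close> also has a neighbour coloured \<open>f y\<close>; with
  \<open>x\<close> and \<open>t\<close> this leaves no room for a hot one. So hot vertices have two
  places: \<open>r\<close> itself and one beyond \<open>z\<close>.\<close>

lemma unreleased:
  assumes r: "hot r" "E x r" and t: "t \<in> S0" "E r t" "t \<noteq> x" "f t = f x"
    and nx: "\<And>b. E x b \<Longrightarrow> b = w1 \<or> b = r \<or> b = z" and a: "hot a" "near 2 x a"
    and z: "z \<in> S0" "f z = f y"
  shows "a = r \<or> E z a"
proof -
  obtain q where q: "q \<in> S0" "E r q" "f q = f y" using sat_hot[OF r(1)] by blast
  have "x \<noteq> q" "t \<noteq> q" using q t neq_xy by auto
  then have "b = x \<or> b = t \<or> b = q" if "E r b" for b
    using nbr_cases[of r x t q b] adj_sym[OF r(2)] t q that by auto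
  then have "\<not> hot b" if "E r b" for b
    using that one_xy q(3) t(4) unfolding hot_def by metis
  then show ?thesis
    using near_2_hot[OF a(2,1)] nx a(1) z(2) one_xy v_notin unfolding hot_def by metis
qed

text \<open>Besides \<open>r\<close> there is at most one place beyond \<open>r\<close>, by
  \<open>hot_nbr_unique_hot\<close> below, and one beyond \<open>z\<close>.\<close>

lemma released:
  assumes r: "hot r" "E x r" 
    and nx: "\<And>b. E x b \<Longrightarrow> b = w1 \<or> b = r \<or> b = z" and a: "hot a" "near 2 x a" "a \<noteq> r"
    and z: "z \<in> S0" "f z = f y"
  shows "E r a \<or> E z a"
  using near_2_hot[OF a(2,1)] nx a(1,3) z(2) one_xy v_notin unfolding hot_def by metis

lemma hot_nbr_unique_hot:
  assumes r: "hot r" "E x r" and "E r s" "E r t" "hot s" "hot t"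
  shows "s = t"
proof -
  obtain q where q: "q \<in> S0" "E r q" "f q = f y" using sat_hot[OF r(1)] by blast
  have "\<not> hot q" "x \<noteq> q" using q one_xy neq_xy by (auto simp: hot_def)
  then show ?thesis using hot_nbr_unique[of r x q s t] assms q hot_xy adj_sym by blast
qed

lemma not_movable_hot:
  assumes "rad c = 2" "\<not> movable c" obtains a where "hot a" "near 2 x a" "f a = c"
  using movable_direct[OF assms(1)] assms(2) by blast

text \<open>The next three lemmas count: by saturation and the flips above there are at most three hot
  vertices within distance 2 of \<open>x\<close>, and if \<open>x\<close> is not movable to \<open>c\<close>, then one of them has colour
  \<open>c\<close>.\<close>

lemma no_three:
  assumes r: "hot r" "E x r" "rad (f r) = 2" and nm: "\<not> movable 4" "\<not> movable 5"
    and a: "hot a" "near 2 x a"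
  shows "rad (f a) \<noteq> 3"
proof
  assume a3: "rad (f a) = 3"
  obtain z where z: "z \<in> S0" "f z = f y" and nx: "\<And>b. E x b \<Longrightarrow> b = w1 \<or> b = r \<or> b = z"
    and uz: "\<And>s t. E z s \<Longrightarrow> E z t \<Longrightarrow> hot s \<Longrightarrow> hot t \<Longrightarrow> s = t"
    using hot_nbr_x[OF r(1,2)] by blast
  have ar: "a \<noteq> r" using a3 r by auto
  show False
  \<comment> \<open>If \<open>r\<close> cannot be released, \<open>p\<close>, \<open>q\<close>,
    \<open>a\<close> compete for the places \<open>r\<close> and beyond \<open>z\<close>. If it can,
    all three differ from \<open>r\<close> and compete for one place beyond \<open>r\<close> and one
    beyond \<open>z\<close>.\<close>
  proof (cases "\<exists>t\<in>S0. E r t \<and> t \<noteq> x \<and> f t = f x")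
    case True
    then obtain t where t: "t \<in> S0" "E r t" "t \<noteq> x" "f t = f x" by blast
    obtain p q where pq: "hot p" "near 2 x p" "f p = 4" "hot q" "near 2 x q" "f q = 5"
      using not_movable_hot[OF rad_simps(3) nm(1)] not_movable_hot[OF rad_simps(4) nm(2)] by metis
    have key: "s = r \<or> E z s" if "hot s" "near 2 x s" for s
      by (rule unreleased[OF r(1,2) t nx that z])
    have "E z a" "p = r \<or> E z p" "q = r \<or> E z q"
      using key a pq(1,2,4,5) ar by auto
    moreover have "p \<noteq> q" "a \<noteq> p" "a \<noteq> q" using a3 pq by auto
    ultimately show False using uz[of a p] uz[of a q] a(1) pq(1,4) by auto
  next
    case False
    then obtain p q where pq: "hot p" "near 2 x p" "p \<noteq> r" "f p = 4" "hot q" "near 2 x q" "q \<noteq> r" "f q = 5"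
      using movable_release[OF rad_simps(3) r(1,2)] movable_release[OF rad_simps(4) r(1,2)] nm by metis
    have key: "E r s \<or> E z s" if "hot s" "near 2 x s" "s \<noteq> r" for s
      by (rule released[OF r(1,2) nx that z])
    have "E r a \<or> E z a" "E r p \<or> E z p" "E r q \<or> E z q"
      using key a pq(1-3,5-7) ar by auto
    moreover have "a \<noteq> p" "a \<noteq> q" "p \<noteq> q" using a3 pq by auto
    ultimately show False using uz hot_nbr_unique_hot[OF r(1,2)] a pq by metis
  qed
qed

lemma not_both_three:
  assumes r: "hot r" "E x r" "rad (f r) = 2" and c: "rad c = 2" "\<not> movable c"
    and a: "hot a" "near 2 x a" "f a = 6" and b: "hot b" "near 2 x b" "f b = 7"
  shows False
proof -
  obtain z where z: "z \<in> S0" "f z = f y" and nx: "\<And>b. E x b \<Longrightarrow> b = w1 \<or> b = r \<or> b = z"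
    and uz: "\<And>s t. E z s \<Longrightarrow> E z t \<Longrightarrow> hot s \<Longrightarrow> hot t \<Longrightarrow> s = t"
    using hot_nbr_x[OF r(1,2)] by blast
  have abr: "a \<noteq> r" "b \<noteq> r" "a \<noteq> b" using a b r by auto
  show False
  \<comment> \<open>Neither \<open>a\<close> nor \<open>b\<close> is \<open>r\<close>. Without
    release both would need the one place beyond \<open>z\<close>; with release, \<open>p\<close> of
    colour \<open>c\<close> is a third vertex for two places.\<close>
  proof (cases "\<exists>t\<in>S0. E r t \<and> t \<noteq> x \<and> f t = f x")
    case True
    then obtain t where t: "t \<in> S0" "E r t" "t \<noteq> x" "f t = f x" by blast
    have key: "s = r \<or> E z s" if "hot s" "near 2 x s" for s
      by (rule unreleased[OF r(1,2) t nx that z])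
    have "E z a" "E z b" using key a(1,2) b(1,2) abr by auto
    then show False using uz[of a b] a(1) b(1) abr by blast
  next
    case False
    then obtain p where p: "hot p" "near 2 x p" "p \<noteq> r" "f p = c"
      using movable_release[OF c(1) r(1,2)] c by blast
    have key: "E r s \<or> E z s" if "hot s" "near 2 x s" "s \<noteq> r" for s
      by (rule released[OF r(1,2) nx that z])
    have "E r a \<or> E z a" "E r p \<or> E z p" "E r b \<or> E z b"
      using key a(1,2) p(1-3) b(1,2) abr by auto
    moreover have "a \<noteq> p" "b \<noteq> p" using a b c p by auto
    ultimately show False using uz hot_nbr_unique_hot[OF r(1,2)] a b p abr by metis
  qed
qed

lemma not_both_three_interior:
  assumes nm: "(\<And>b. E x b \<Longrightarrow> b \<in> S) \<Longrightarrow> \<not> movable 4 \<and> \<not> movable 5"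
    and a: "hot a" "near 2 x a" "f a = 6" and b: "hot b" "near 2 x b" "f b = 7"
  shows False
proof -
  have ab: "a \<noteq> b" using a b by auto
  obtain z1 where z1: "z1 \<in> S0" "E x z1" "f z1 = f y" by (rule opp_nbr)
  \<comment> \<open>In the first two cases all neighbours of \<open>x\<close> lie in
    \<open>S\<close>, so by \<open>nm\<close> vertices of the colours 4 and 5 compete with
    \<open>a\<close> and \<open>b\<close> for at most three places. In the last case the only place
    is beyond \<open>z1\<close>.\<close>
  consider r where "hot r" "E x r" | z2 where "\<And>r. E x r \<Longrightarrow> \<not> hot r" "z2 \<in> S0" "E x z2" "f z2 = f y" "z2 \<noteq> z1"
    | "\<And>r. E x r \<Longrightarrow> \<not> hot r" "\<And>z. z \<in> S0 \<Longrightarrow> E x z \<Longrightarrow> f z = f y \<Longrightarrow> z = z1" by blast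
  then show False
  proof cases
    case (1 r)
    obtain z where z: "z \<in> S0" "f z = f y" and nx: "\<And>b. E x b \<Longrightarrow> b = w1 \<or> b = r \<or> b = z"
      and uz: "\<And>s t. E z s \<Longrightarrow> E z t \<Longrightarrow> hot s \<Longrightarrow> hot t \<Longrightarrow> s = t"
      using hot_nbr_x[OF 1] by blast
    have nm': "\<not> movable 4" "\<not> movable 5"
      using nm nx hot_S0[OF 1(1)] z(1) S(2) by blast+
    have abr: "a \<noteq> r \<or> b \<noteq> r" using ab by auto
    show False
    proof (cases "\<exists>t\<in>S0. E r t \<and> t \<noteq> x \<and> f t = f x")
      case True
      then obtain t where t: "t \<in> S0" "E r t" "t \<noteq> x" "f t = f x" by blast
      obtain p q where pq: "hot p" "near 2 x p" "f p = 4" "hot q" "near 2 x q" "f q = 5"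
        using not_movable_hot[OF rad_simps(3) nm'(1)] not_movable_hot[OF rad_simps(4) nm'(2)] by metis
      have key: "s = r \<or> E z s" if "hot s" "near 2 x s" for s
      by (rule unreleased[OF 1 t nx that z])
      have "a = r \<or> E z a" "b = r \<or> E z b" "p = r \<or> E z p" "q = r \<or> E z q"
        using key a(1,2) b(1,2) pq(1,2,4,5) by auto
      moreover have "a \<noteq> p" "a \<noteq> q" "p \<noteq> q" "b \<noteq> p" "b \<noteq> q" using a b pq by auto
      ultimately show False using uz a b pq ab by metis
    next
      case False
      then obtain p q where pq: "hot p" "near 2 x p" "p \<noteq> r" "f p = 4" "hot q" "near 2 x q" "q \<noteq> r" "f q = 5"
        using movable_release[OF rad_simps(3) 1] movable_release[OF rad_simps(4) 1] nm' by metis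
      obtain d where d: "hot d" "near 2 x d" "d \<noteq> r" "d = a \<or> d = b" using abr a b by blast
      have key: "E r s \<or> E z s" if "hot s" "near 2 x s" "s \<noteq> r" for s
      by (rule released[OF 1 nx that z])
      have "E r d \<or> E z d" "E r p \<or> E z p" "E r q \<or> E z q"
        using key d(1-3) pq(1-3,5-7) by auto
      moreover have "d \<noteq> p" "d \<noteq> q" "p \<noteq> q" using a b d pq by auto
      ultimately show False using uz hot_nbr_unique_hot[OF 1] d pq by metis
    qed
  next
    case (2 z2)
    have nx: "\<And>b. E x b \<Longrightarrow> b = w1 \<or> b = z1 \<or> b = z2"
      using nbr_cases[of x w1 z1 z2] 2(2,3,5) z1 adj_sym[OF xy(4)] by auto
    then have nm': "\<not> movable 4" "\<not> movable 5"
      using nm 2 z1 S(2) by blast+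
    obtain p q where pq: "hot p" "near 2 x p" "f p = 4" "hot q" "near 2 x q" "f q = 5"
      using not_movable_hot[OF rad_simps(3) nm'(1)] not_movable_hot[OF rad_simps(4) nm'(2)] by metis
    let ?H = "{s. (E z1 s \<or> E z2 s) \<and> hot s}"
    have mem: "s \<in> ?H" if "hot s" "near 2 x s" for s
      using near_2_hot[OF that(2,1)] that nx 2(1) v_notin(2) by blast
    have "{a, b, p, q} \<subseteq> ?H" using mem[OF a(1,2)] mem[OF b(1,2)] mem[OF pq(1,2)] mem[OF pq(4,5)] by blast
    moreover have "a \<noteq> p" "a \<noteq> q" "b \<noteq> p" "b \<noteq> q" "p \<noteq> q"
      using a(3) b(3) pq(3,6) by auto
    then have "card {a, b, p, q} = 4" using ab by simp
    moreover have "finite ?H" "card ?H \<le> 3"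
      using hot_beyond_card[OF z1 2(2-4) 2(5)[symmetric]] by blast+
    ultimately show False
      using card_mono[of ?H "{a, b, p, q}"] by linarith
  next
    case 3
    have mem: "E z1 s" if s: "hot s" "near 2 x s" for s
    proof -
      obtain t where t: "t \<in> S0" "E x t" "E t s" using near_2_hot[OF s(2,1)] s(1) 3(1) by blast
      then have "rad (f t) = 1" using 3(1) unfolding hot_def by blast
      then have "t = z1" using nbr_one[OF xy(1) refl t(2,1)] 3(2)[OF t(1,2)] by blast
      with t show ?thesis by blast
    qed
    have "E z1 a" "E z1 b" using mem a(1,2) b(1,2) by auto
    then show False using hot_beyond_unique[OF z1 3(2)] a(1) b(1) ab by blast
  qed
qed

section \<open>Consequences of moving \<open>x\<close> to class 2\<close>

lemma movable_partial:
  assumes m: "movable c" "rad c = 2" and int: "\<And>b. E x b \<Longrightarrow> b \<in> S"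
  obtains g where "partial g" "g x = c" "\<forall>a. a \<noteq> x \<longrightarrow> g a \<noteq> f a \<longrightarrow> hot a \<and> E x a \<and> g a = f x"
proof -
  obtain g where g: "valid S0 g" "g x = c" "\<forall>a. a \<noteq> x \<longrightarrow> g a \<noteq> f a \<longrightarrow> hot a \<and> E x a \<and> g a = f x"
    using m(1) unfolding movable_def by auto
  have "rad (g a) = 1" if "a \<in> S0" "E a b" "b \<notin> S" for a b
  proof -
    have "a \<noteq> x" using int that by blast
    then show ?thesis using g(3)[rule_format, of a] boundary_one[OF that] one_xy by metis
  qed
  moreover have "rad (g w2) \<noteq> 3"
  proof (cases "w2 = x \<or> g w2 = f w2")
    case True
    then show ?thesis using g(2) m(2) partial_f unfolding partial_def by auto
  next
    case False
    then show ?thesis using g(3)[rule_format, of w2] one_xy by auto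
  qed
  ultimately show thesis using that[of g] g unfolding partial_def by blast
qed

lemma moved_nbr_w1:
  assumes "rad c = 2" "g x = c" "\<forall>a. a \<noteq> x \<longrightarrow> g a \<noteq> f a \<longrightarrow> hot a \<and> E x a \<and> g a = f x"
    and a: "a \<in> S0" "E w1 a"
  shows "g a = c \<or> g a = f y" "g a \<noteq> f x"
proof -
  have "g y = f y" using assms(3)[rule_format, of y] xy(3) hot_xy(2) by blast
  moreover have "a = x \<or> a = y" using nbr_w1[OF a(2)] a(1) by auto
  ultimately show "g a = c \<or> g a = f y" using assms(2) by auto
  then show "g a \<noteq> f x" using assms(1) one_xy neq_xy by auto
qed

text \<open>After the move, \<open>f x\<close> is free for \<open>w1\<close>, and \<open>f y\<close>
  for \<open>v\<close>.\<close>

lemma movable_away: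
  assumes m: "rad c = 2" "movable c" and int: "\<And>b. E x b \<Longrightarrow> b \<in> S" and w2: "f w2 \<noteq> f y"
  shows False
proof -
  obtain g where g: "partial g" "g x = c" "\<forall>a. a \<noteq> x \<longrightarrow> g a \<noteq> f a \<longrightarrow> hot a \<and> E x a \<and> g a = f x"
    using movable_partial[OF m(2,1) int] by blast
  have "g w2 \<noteq> f y"
  proof (cases "w2 = x")
    case True
    then show ?thesis using g(2) m(1) one_xy(2) by auto
  next
    case False
    then show ?thesis using g(3)[rule_format, of w2] w2 neq_xy by auto
  qed
  then have "g w2 \<noteq> 5 - f x" using fy by simp
  moreover note w1 = moved_nbr_w1(2)[OF m(1) g(2,3)]
  ultimately show False using finish_one_one[OF g(1) one_xy(1) w1] no_good by blast
qed

text \<open>The last two conclusions record that, after the move, the second and third alternatives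
  of \<open>extend_uncolored_pair\<close> fail.\<close>

lemma movable_pair:
  assumes m: "rad c = 2" "movable c" and int: "\<And>b. E x b \<Longrightarrow> b \<in> S"
  obtains g where "g x = c" "\<forall>a. a \<noteq> x \<longrightarrow> g a \<noteq> f a \<longrightarrow> hot a \<and> E x a \<and> g a = f x"
    "\<exists>a\<in>S0. E w2 a \<and> g a = 9 - c"
    "\<not> E w1 w2 \<Longrightarrow> \<exists>a\<in>S0. E w2 a \<and> g a = f x"
proof -
  obtain g where g: "partial g" "g x = c" "\<forall>a. a \<noteq> x \<longrightarrow> g a \<noteq> f a \<longrightarrow> hot a \<and> E x a \<and> g a = f x"
    using movable_partial[OF m(2,1) int] by blast
  note w1 = moved_nbr_w1[OF m(1) g(2,3)]
  have no: "\<not> (g w2 \<noteq> 5 - f x \<or> (\<exists>d. rad d = 2 \<and> (\<forall>a\<in>S0. E w1 a \<or> E w2 a \<longrightarrow> g a \<noteq> d)) \<or>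
      (\<not> E w1 w2 \<and> (\<forall>a\<in>S0. E w2 a \<longrightarrow> g a \<noteq> f x)))"
    using extend_uncolored_pair[OF g(1) one_xy(1) w1(2)] no_good by blast
  have "g a \<noteq> 9 - c" if "a \<in> S0" "E w1 a" for a
    using w1(1)[OF that] rad_opp2(1,2)[OF m(1)] one_xy by auto
  then have "\<exists>a\<in>S0. E w2 a \<and> g a = 9 - c"
    using no rad_opp2(1)[OF m(1)] by blast
  then show thesis using that g(2,3) no by blast
qed

lemma hot_nbr_x_unique:
  assumes "hot r" "E x r" "hot s" "E x s" shows "r = s"
proof -
  obtain z where z: "z \<in> S0" "f z = f y" "\<And>b. E x b \<Longrightarrow> b = w1 \<or> b = r \<or> b = z"
    "\<And>s t. E z s \<Longrightarrow> E z t \<Longrightarrow> hot s \<Longrightarrow> hot t \<Longrightarrow> s = t"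
    using hot_nbr_x[OF assms(1,2)] by blast
  have "\<not> hot z" "\<not> hot w1" using z(2) one_xy by (auto simp: hot_def)
  then show ?thesis using z(3)[OF assms(4)] assms(3) by blast
qed

lemma hot_nbr_x_interior:
  assumes "hot r" "E x r" "E x b" shows "b \<in> S"
proof -
  obtain z where z: "z \<in> S0" "f z = f y" "\<And>b. E x b \<Longrightarrow> b = w1 \<or> b = r \<or> b = z"
    "\<And>s t. E z s \<Longrightarrow> E z t \<Longrightarrow> hot s \<Longrightarrow> hot t \<Longrightarrow> s = t"
    using hot_nbr_x[OF assms(1,2)] by blast
  then show ?thesis using z(3)[OF assms(3)] hot_S0[OF assms(1)] S(2) by blast
qed

text \<open>By \<open>movable_pair\<close>, a move would require neighbours of \<open>w2\<close>
  coloured \<open>9 - c\<close> and \<open>f x\<close> in addition to \<open>t\<close> and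
  \<open>v\<close>, which exceeds the degree.\<close>

lemma not_movable_three:
  assumes r: "hot r" "E x r" "rad (f r) = 2" and t: "hot t" "E w2 t" "rad (f t) = 3" and c: "rad c = 2"
  shows "\<not> movable c"
proof
  assume m: "movable c"
  obtain g where g: "g x = c" "\<forall>a. a \<noteq> x \<longrightarrow> g a \<noteq> f a \<longrightarrow> hot a \<and> E x a \<and> g a = f x"
    "\<exists>a\<in>S0. E w2 a \<and> g a = 9 - c"
    "\<not> E w1 w2 \<Longrightarrow> \<exists>a\<in>S0. E w2 a \<and> g a = f x"
    using movable_pair[OF c m hot_nbr_x_interior[OF r(1,2)]] by blast
  have tr: "t \<noteq> r" "t \<noteq> x" using t r one_xy by auto
  have gt: "g t = f t" using g(2)[rule_format, OF tr(2)] hot_nbr_x_unique[OF r(1,2)] tr(1) by blast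
  obtain p where p: "p \<in> S0" "E w2 p" "g p = 9 - c" using g(3) by blast
  have pt: "p \<noteq> t" using p(3) gt t(3) rad_opp2(1)[OF c] by auto
  note w = w2_two_nbrs[OF p(1) hot_S0[OF t(1)] p(2) t(2) pt]
  obtain a where a: "a \<in> S0" "E w2 a" "g a = f x" using g(4) w(1) by blast
  have "a = p \<or> a = t" using w(2)[OF a(2)] a(1) by blast
  then show False using a(3) p(3) gt t(3) rad_opp2(1)[OF c] one_xy(1) by auto
qed

text \<open>If both moves were possible, \<open>w2\<close> would have neighbours \<open>p\<close>,
  \<open>q\<close> with the colours \<open>f r\<close> and \<open>9 - f r\<close>, which exhaust its
  degree. Moving \<open>x\<close> to \<open>9 - f r\<close> leaves \<open>q\<close> unchanged, so
  \<open>p\<close> would have to carry both \<open>f r\<close> and \<open>f x\<close>.\<close>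

lemma ex_not_movable:
  assumes r: "hot r" "E x r" "rad (f r) = 2"
  shows "\<exists>c. rad c = 2 \<and> \<not> movable c"
proof (rule ccontr)
  assume "\<not> ?thesis"
  then have m: "movable c" if "rad c = 2" for c using that by blast
  have pair: "\<exists>g. g x = c \<and> (\<forall>a. a \<noteq> x \<longrightarrow> g a \<noteq> f a \<longrightarrow> hot a \<and> E x a \<and> g a = f x) \<and>
    (\<exists>a\<in>S0. E w2 a \<and> g a = 9 - c) \<and> (\<not> E w1 w2 \<longrightarrow> (\<exists>a\<in>S0. E w2 a \<and> g a = f x))" if c: "rad c = 2" for c
    using movable_pair[OF c m[OF c] hot_nbr_x_interior[OF r(1,2)]] by blast
  have ex: "\<exists>a\<in>S0. E w2 a \<and> f a = d" if d: "rad d = 2" for d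
  proof -
    note d' = rad_opp2(1,3,2)[OF d]
    obtain g a where g: "g x = 9 - d" "\<forall>a. a \<noteq> x \<longrightarrow> g a \<noteq> f a \<longrightarrow> hot a \<and> E x a \<and> g a = f x"
      and a: "a \<in> S0" "E w2 a" "g a = d"
      using pair[OF d'(1)] unfolding d'(2) by blast
    have "a \<noteq> x" using g(1) a(3) d'(3) by auto
    moreover have "g a \<noteq> f x" using a(3) d one_xy(1) by auto
    ultimately have "g a = f a" using g(2) by blast
    then show ?thesis using a by auto
  qed
  define d where "d = f r"
  have "rad d = 2" using r(3) by (simp add: d_def)
  note d = this rad_opp2(1,3,2)[OF this]
  obtain p q where p: "p \<in> S0" "E w2 p" "f p = d" and q: "q \<in> S0" "E w2 q" "f q = 9 - d"
    using ex[OF d(1)] ex[OF d(2)] by blast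
  have pq: "p \<noteq> q" using p q d(4) by auto
  note w = w2_two_nbrs[OF p(1) q(1) p(2) q(2) pq]
  obtain g where g: "g x = 9 - d" "\<forall>a. a \<noteq> x \<longrightarrow> g a \<noteq> f a \<longrightarrow> hot a \<and> E x a \<and> g a = f x"
    and a: "\<exists>a\<in>S0. E w2 a \<and> g a = d" "\<exists>a\<in>S0. E w2 a \<and> g a = f x"
    using pair[OF d(2)] w(1) unfolding d(3) by blast
  have px: "p \<noteq> x" "q \<noteq> x" using p q d one_xy by auto
  have "q \<noteq> r" using q d by (auto simp: d_def)
  then have gq: "g q = f q" using g(2)[rule_format, OF px(2)] hot_nbr_x_unique[OF r(1,2)] by blast
  have "g p = d" using a(1) w(2) gq q(3) d(4) v_notin(1) by metis
  moreover have "g p = f x" using a(2) w(2) gq q(3) d(2) one_xy(1) v_notin(1) by (metis numeral_eq_one_iff semiring_norm(85))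
  ultimately show False using d(1) one_xy(1) by auto
qed

section \<open>Colours blocked at \<open>w1\<close>\<close>

lemma near_2_w1_hot:
  assumes "near 2 w1 a" "hot a" shows "a = w2 \<or> E x a \<or> E y a"
proof -
  have "a \<noteq> w1" "\<not> E w1 a" using assms(2) nbr_w1[of a] hot_xy v_notin unfolding hot_def by blast+
  then obtain b where b: "E w1 b" "E b a" using assms(1) unfolding near_2 by blast
  then consider "b = v" | "b = x" | "b = y" using nbr_w1 by blast
  then show ?thesis
  proof cases
    case 1
    then have "a = w1 \<or> a = w2 \<or> a = u" using b nbr_v by blast
    then show ?thesis using \<open>a \<noteq> w1\<close> assms(2) S(4) unfolding hot_def by blast
  qed (use b in auto)
qed

lemma near_3_w1_hot:
  assumes "near 3 w1 a" "hot a" shows "a = w2 \<or> E w2 a \<or> near 2 x a \<or> near 2 y a"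
proof -
  have na: "a \<noteq> w1" "\<not> E w1 a" using assms(2) nbr_w1[of a] hot_xy v_notin unfolding hot_def by blast+
  then consider b where "E w1 b" "E b a" | b c where "E w1 b" "E b c" "E c a"
    using assms(1) unfolding near_3 by blast
  then show ?thesis
  proof cases
    case 1
    then have "near 2 w1 a" unfolding near_2 by blast
    then show ?thesis using near_2_w1_hot[OF _ assms(2)] unfolding near_2 by blast
  next
    case (2 b c)
    consider "b = v" | "b = x" | "b = y" using 2 nbr_w1 by blast
    then show ?thesis
    proof cases
      case 1
      then have "c = w1 \<or> c = w2 \<or> c = u" using 2 nbr_v by blast
      moreover have "c \<noteq> u"
        using boundary_one[of a c] adj_sym[OF 2(3)] assms(2) S(4) unfolding hot_def by blast
      ultimately show ?thesis using 2 na by blast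
    qed (use 2 in \<open>unfold near_2, blast+\<close>)
  qed
qed

text \<open>All neighbours of \<open>w1\<close> lie in \<open>S\<close>, so an unblocked
  \<open>c\<close> could be given to \<open>w1\<close>, with \<open>d\<close> for
  \<open>v\<close>.\<close>

lemma blocked_w1:
  assumes c: "rad c = 2 \<or> rad c = 3" and d: "rad d = 1" "f w2 \<noteq> d"
  obtains a where "hot a" "near (rad c) w1 a" "f a = c"
proof (rule ccontr)
  assume no: "\<not> thesis"
  have "f a \<noteq> c" if a: "a \<in> S0" "near (rad c) w1 a" for a
  proof
    assume "f a = c"
    moreover from this have "hot a" using a(1) c by (auto simp: hot_def)
    ultimately show False using no that(2) a \<open>\<And>a. hot a \<Longrightarrow> near (rad c) w1 a \<Longrightarrow> f a = c \<Longrightarrow> thesis\<close> by blast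
  qed
  moreover have "b \<in> S" if "E w1 b" for b using nbr_w1[OF that] S(1) xy(1,2) by blast
  ultimately have "\<exists>g. good S v g" using finish_any_one[OF partial_f c _ _ d] by blast
  with no_good show False by blast
qed

lemma three_w1:
  assumes d: "rad d = 1" "f w2 \<noteq> d" and c: "rad c = 3"
    and x: "\<And>a. hot a \<Longrightarrow> near 2 x a \<Longrightarrow> f a \<noteq> c"
    and y: "\<And>a. hot a \<Longrightarrow> near 2 y a \<Longrightarrow> f a \<noteq> c"
    and w: "\<And>a. hot a \<Longrightarrow> E w2 a \<Longrightarrow> f a \<noteq> c"
  shows False
proof -
  obtain a where a: "hot a" "near (rad c) w1 a" "f a = c"
    using blocked_w1[OF disjI2[OF c] d] by blast
  have "near 3 w1 a" using a(2) c by simp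
  then consider "a = w2" | "E w2 a" | "near 2 x a" | "near 2 y a"
    using near_3_w1_hot a(1) by blast
  then show False
  proof cases
    case 1
    then show ?thesis using a(3) c partial_f unfolding partial_def by blast
  qed (use a w x y in blast)+
qed

text \<open>As \<open>f w2\<close> is neither \<open>f x\<close> nor \<open>f y\<close>,
  \<open>movable_away\<close> applies on both sides. Hence no class 3 occurs near \<open>x\<close>
  and at most one of 6, 7 near \<open>y\<close>. The neighbours of \<open>w2\<close> in
  \<open>S0\<close> are those of class 1 given by saturation, so one of 6, 7 is free for
  \<open>w1\<close>.\<close>

lemma stuck_two_aux:
  assumes w2: "rad (f w2) = 2" and r: "hot r" "E x r" "rad (f r) = 2"
  shows False
proof -
  interpret swap: stuck E S v w1 w2 u y x f by (rule stuck_swap)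
  have nxy: "f w2 \<noteq> f x" "f w2 \<noteq> f y" using w2 one_xy by auto
  have nm: "\<not> movable 4" "\<not> movable 5"
    using movable_away[OF _ _ hot_nbr_x_interior[OF r(1,2)] nxy(2)] rad_simps(3,4) by blast+
  have tx: "rad (f a) \<noteq> 3" if "hot a" "near 2 x a" for a
    using no_three[OF r nm that] .
  have nmy: "\<not> swap.movable 4 \<and> \<not> swap.movable 5" if "\<And>b. E y b \<Longrightarrow> b \<in> S"
    using swap.movable_away[OF _ _ that nxy(1)] rad_simps(3,4) by blast
  have tw: "\<not> hot a" if "E w2 a" for a
  proof -
    have "hot w2" using w2 w2_S0 by (simp add: hot_def)
    then obtain p q where pq: "p \<in> S0" "q \<in> S0" "E w2 p" "E w2 q" "f p = f x" "f q = f y"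
      by (rule sat_hot)
    then have "p \<noteq> q" using neq_xy by auto
    then have "a = v \<or> a = p \<or> a = q" using w2_two_nbrs(2)[OF pq(1-4) _ that] by blast
    then show ?thesis using pq(5,6) one_xy by (auto simp: hot_def)
  qed
  obtain c where c: "c = 6 \<or> c = 7" "\<And>a. hot a \<Longrightarrow> near 2 y a \<Longrightarrow> f a \<noteq> c"
    using swap.not_both_three_interior[OF nmy] by metis
  then have "rad c = 3" by auto
  then show False
    using three_w1[OF one_xy(1) nxy(1), of c] tx tw c(2) by blast
qed

text \<open>The colours 4 and 5 are blocked at \<open>w1\<close> by neighbours of \<open>x\<close>
  and \<open>y\<close>. Each of these has at most one hot neighbour, so both have one of class 2. By
  \<open>movable_away\<close> and \<open>no_three\<close>, no class 3 occurs near \<open>x\<close>.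
  If \<open>w2\<close> has a neighbour \<open>t\<close> of class 3, \<open>y\<close> cannot move
  either and \<open>13 - f t\<close> is free for \<open>w1\<close>; otherwise
  \<open>ex_not_movable\<close> for \<open>y\<close> leaves at most one of 6, 7 near
  \<open>y\<close>.\<close>

lemma stuck_one_aux:
  assumes w2: "f w2 = f x"
  shows False
proof -
  interpret swap: stuck E S v w1 w2 u y x f by (rule stuck_swap)
  have nwy: "f w2 \<noteq> f y" using w2 neq_xy by simp
  have ex: "\<exists>a. hot a \<and> (E x a \<or> E y a) \<and> f a = c" if c: "rad c = 2" for c
  proof -
    obtain a where a: "hot a" "near (rad c) w1 a" "f a = c"
      using blocked_w1[OF disjI1[OF c] one_xy(2) nwy] by blast
    have "a \<noteq> w2" using a(3) c w2 one_xy(1) by auto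
    then show ?thesis using near_2_w1_hot[of a] a c by auto
  qed
  obtain a4 a5 where a4: "hot a4" "E x a4 \<or> E y a4" "f a4 = 4" and a5: "hot a5" "E x a5 \<or> E y a5" "f a5 = 5"
    using ex[of 4] ex[of 5] by auto
  have a45: "a4 \<noteq> a5" using a4(3) a5(3) by auto
  have "\<exists>r s. hot r \<and> E x r \<and> rad (f r) = 2 \<and> hot s \<and> E y s \<and> rad (f s) = 2"
  proof (cases "E x a4")
    case True
    then have "E y a5" using a5(1,2) a45 hot_nbr_x_unique[OF a4(1) True] by blast
    then show ?thesis using True a4 a5 rad_simps(3,4) by metis
  next
    case False
    then have "E y a4" using a4(2) by blast
    then have "E x a5" using a5(1,2) a45 swap.hot_nbr_x_unique[OF a4(1)] by blast
    then show ?thesis using \<open>E y a4\<close> a4 a5 rad_simps(3,4) by metis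
  qed
  then obtain r s where r: "hot r" "E x r" "rad (f r) = 2" and s: "hot s" "E y s" "rad (f s) = 2"
    by blast
  have nm: "\<not> movable 4" "\<not> movable 5"
    using movable_away[OF _ _ hot_nbr_x_interior[OF r(1,2)] nwy] rad_simps(3,4) by blast+
  have tx: "rad (f a) \<noteq> 3" if "hot a" "near 2 x a" for a
    using no_three[OF r nm that] .
  show False
  proof (cases "\<exists>t. hot t \<and> E w2 t \<and> rad (f t) = 3")
    case True
    then obtain t where t: "hot t" "E w2 t" "rad (f t) = 3" by blast
    have ty: "rad (f a) \<noteq> 3" if "hot a" "near 2 y a" for a
      using swap.no_three[OF s swap.not_movable_three[OF s t] swap.not_movable_three[OF s t] that] by simp
    define c where "c = 13 - f t"
    have c: "rad c = 3" "f t \<noteq> c" using t(3) unfolding c_def rad_3_iff by auto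
    have "f a \<noteq> c" if "hot a" "E w2 a" for a
    proof
      assume "f a = c"
      then have "a = t"
        using good_f t that hot_S0[OF t(1)] hot_S0[OF that(1)] c(1) unfolding good_def by blast
      with c(2) \<open>f a = c\<close> show False by simp
    qed
    then show False using three_w1[OF one_xy(2) nwy c(1)] tx ty c(1) by blast
  next
    case False
    obtain d where d: "rad d = 2" "\<not> swap.movable d" using swap.ex_not_movable[OF s] by blast
    obtain c where c: "c = 6 \<or> c = 7" "\<And>a. hot a \<Longrightarrow> near 2 y a \<Longrightarrow> f a \<noteq> c"
      using swap.not_both_three[OF s d] by metis
    then have "rad c = 3" by auto
    then show False
      using three_w1[OF one_xy(2) nwy, of c] tx False c(2) by blast
  qed
qed

lemma never_stuck: False
proof -
  interpret swap: stuck E S v w1 w2 u y x f by (rule stuck_swap)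
  have "rad (f w2) = 1 \<or> rad (f w2) = 2" using partial_w2[OF partial_f] .
  then show False
  proof
    assume "rad (f w2) = 1"
    then show False using one_cases stuck_one_aux swap.stuck_one_aux by blast
  next
    assume w2: "rad (f w2) = 2"
    \<comment> \<open>The blocker of the other colour of class 2 cannot be \<open>w2\<close>; it is
      the hot neighbour of \<open>x\<close> or \<open>y\<close> that \<open>stuck_two_aux\<close>
      asks for.\<close>
    define c where "c = 9 - f w2"
    have c: "rad c = 2" "c \<noteq> f w2" using rad_opp2(1,2)[OF w2] by (auto simp: c_def)
    have "f w2 \<noteq> f x" using w2 one_xy by auto
    then obtain a where a: "hot a" "near (rad c) w1 a" "f a = c"
      using blocked_w1[OF disjI1[OF c(1)] one_xy(1)] by blast
    have "near 2 w1 a" "a \<noteq> w2" using a c by auto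
    then have "E x a \<or> E y a" using near_2_w1_hot a(1) by blast
    then show False using stuck_two_aux[OF w2 a(1)] swap.stuck_two_aux[OF w2 a(1)] a(3) c(1) by blast
  qed
qed

end

section \<open>The case that removing \<open>w1\<close> disconnects the rest\<close>

context pending_vertex begin

lemma partial_good:
  assumes "good S0 w2 f" shows "partial f"
proof -
  have "rad (f a) = 1" if "a \<in> S0" "E a b" "b \<notin> S" for a b
    by (rule good_inner[OF assms w2_S0 adj_sym[OF adj_v(2)], of a b]) (use that S in auto)
  then show ?thesis using assms unfolding partial_def good_def by blast
qed

text \<open>The colours of \<open>B\<close> can be permuted independently of \<open>A\<close>. This
  freedom makes \<open>y\<close> agree with \<open>x\<close> if both have class 1; if
  \<open>y\<close> has class 2, it keeps \<open>y\<close> apart from \<open>w2\<close> or frees a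
  colour of class 2 for \<open>v\<close>.\<close>

lemma extend_split:
  assumes AB: "A \<union> B = S0" "A \<inter> B = {}" "\<And>a b. a \<in> A \<Longrightarrow> b \<in> B \<Longrightarrow> \<not> E a b"
    and xy: "x \<in> A" "y \<in> B" "E w1 x" "E w1 y" "w2 \<in> A"
    and nb: "\<And>a. a \<in> S0 \<Longrightarrow> E w1 a \<Longrightarrow> a = x \<or> a = y"
    and f: "good A w2 f" and g0: "good B y g0"
  shows "\<exists>g. good S v g"
proof -
  define h where "h g a = (if a \<in> A then f a else g a)" for g a
  have hA: "h g a = f a" if "a \<in> A" for g a using that by (simp add: h_def)
  have hB: "h g a = g a" if "a \<in> B" for g a using that AB(2) by (auto simp: h_def)
  have part: "partial (h g)" if g: "good B y g" and roots: "rad (f w2) = 2 \<Longrightarrow> f w2 \<noteq> g y" for g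
  proof -
    have "valid S0 (h g)"
      unfolding h_def AB(1)[symmetric] by (rule valid_combine[OF f g AB(2,3) roots])
    moreover have "rad (h g a) = 1" if "a \<in> S0" "E a b" "b \<notin> S" for a b
    proof (cases "a \<in> A")
      case True
      have "rad (f a) = 1"
        by (rule good_inner[OF f xy(5) adj_sym[OF adj_v(2)] _ True that(2)]) (use that AB(1) S in blast)+
      then show ?thesis using True hA by simp
    next
      case False
      then have a: "a \<in> B" using that AB(1) by blast
      have "rad (g a) = 1"
        by (rule good_inner[OF g xy(2) adj_sym[OF xy(4)] _ a that(2)]) (use that AB(1) S in blast)+
      then show ?thesis using a hB by simp
    qed
    moreover have "rad (h g w2) \<noteq> 3" using f xy(5) hA unfolding good_def by auto
    ultimately show ?thesis unfolding partial_def by blast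
  qed
  have x1: "rad (f x) = 1 \<or> x = w2"
    using good_boundary[OF f xy(1) adj_sym[OF xy(3)]] AB(1) by blast
  have xr: "rad (f x) = 1 \<or> rad (f x) = 2"
    using x1 good_root[OF f xy(5)] by blast
  have wr: "rad (f w2) = 1 \<or> rad (f w2) = 2" using good_root[OF f xy(5)] .
  show ?thesis
  proof (cases "rad (g0 y) = 1")
    case True
    \<comment> \<open>In the second branch \<open>f x\<close> has class 2, so \<open>y\<close> alone
      occupies a colour of class 1 at \<open>w1\<close>.\<close>
    define d where "d = (if rad (f x) = 1 then f x else g0 y)"
    have d: "rad d = 1" using True by (simp add: d_def)
    obtain g where g: "good B y g" "g y = d"
      using good_recolor_root[OF g0, of d] d True by auto
    have "f w2 \<noteq> g y" if "rad (f w2) = 2" using that d g(2) by auto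
    from part[OF g(1) this] have "partial (h g)" .
    moreover have "h g a \<noteq> 5 - d \<and> (rad (h g a) = 1 \<or> a = w2)" if "a \<in> S0" "E w1 a" for a
    proof (cases "a = x")
      case True
      have "f x \<noteq> 5 - d" using rad_opp(1,2)[OF d] xr by (auto simp: d_def split: if_splits)
      then show ?thesis using True hA[OF xy(1)] x1 by simp
    next
      case False
      then have "a = y" using nb that by blast
      then show ?thesis using hB[OF xy(2)] g(2) d rad_opp(2)[OF d] by auto
    qed
    ultimately show ?thesis using extend_uncolored_pair_one[of "h g" "5 - d"] rad_opp(1)[OF d] by blast
  next
    case False
    then have y2: "rad (g0 y) = 2" using good_root[OF g0 xy(2)] by blast
    \<comment> \<open>A colour for \<open>w1\<close>; the choice 2 is arbitrary, as then neither
      \<open>x\<close> nor \<open>y\<close> has class 1.\<close>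
    define c where "c = (if rad (f x) = 1 then 5 - f x else 2)"
    have c: "rad c = 1" using rad_opp(1)[of "f x"] by (simp add: c_def)
    have fxc: "f x \<noteq> c" using rad_opp(2)[of "f x"] by (auto simp: c_def)
    have fin: "\<exists>g. good S v g" if g: "good B y g" "rad (g y) = 2" "rad (f w2) = 2 \<Longrightarrow> f w2 \<noteq> g y"
      and alt: "h g w2 \<noteq> 5 - c \<or> (\<exists>d. rad d = 2 \<and> (\<forall>a\<in>S0. E w1 a \<or> E w2 a \<longrightarrow> h g a \<noteq> d)) \<or>
        (\<not> E w1 w2 \<and> (\<forall>a\<in>S0. E w2 a \<longrightarrow> h g a \<noteq> c))" for g
    proof (rule extend_uncolored_pair[OF part[OF g(1,3)] c _ alt])
      fix a assume "a \<in> S0" "E w1 a"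
      then consider "a = x" | "a = y" using nb by blast
      then show "h g a \<noteq> c"
      proof cases
        case 1
        then show ?thesis using hA[OF xy(1)] fxc by simp
      next
        case 2
        then show ?thesis using hB[OF xy(2)] c g(2) by auto
      qed
    qed
    have recolor: "\<exists>g. good B y g \<and> g y = d" if "rad d = 2" for d
      using good_recolor_root[OF g0, of d] that y2 by auto
    show ?thesis
    proof (cases "rad (f w2) = 2")
      case True
      note d = rad_opp2(1,2)[OF True]
      obtain g where g: "good B y g" "g y = 9 - f w2" using recolor[OF d(1)] by blast
      have "h g w2 \<noteq> 5 - c" using hA[OF xy(5)] True rad_opp(1)[OF c] by auto
      moreover have "rad (g y) = 2" "f w2 \<noteq> g y" using g(2) d by auto
      ultimately show ?thesis using fin[OF g(1)] by blast
    next
      case False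
      then have w1: "rad (f w2) = 1" using wr by blast
      have x1': "rad (f x) = 1" using x1 w1 by auto
      have nbA: "a \<in> A" if "a \<in> S0" "E w2 a" for a using that AB(1,3) xy(5) by blast
      show ?thesis
      proof (cases "\<exists>d. rad d = 2 \<and> (\<forall>a\<in>A. E w2 a \<longrightarrow> f a \<noteq> d)")
        case True
        then obtain d where d: "rad d = 2" "\<forall>a\<in>A. E w2 a \<longrightarrow> f a \<noteq> d" by blast
        \<comment> \<open>With \<open>9 - d\<close> on \<open>y\<close>, the colour \<open>d\<close>
          stays available for \<open>v\<close>.\<close>
        obtain g where g: "good B y g" "g y = 9 - d" using recolor[OF rad_opp2(1)[OF d(1)]] by blast
        have "h g a \<noteq> d" if a: "a \<in> S0" "E w1 a \<or> E w2 a" for a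
        proof -
          consider "E w2 a" | "a = x" | "a = y" using a nb by blast
          then show ?thesis
          proof cases
            case 1
            then show ?thesis using hA[OF nbA[OF a(1) 1]] d(2) nbA[OF a(1) 1] by simp
          next
            case 2
            then show ?thesis using hA[OF xy(1)] x1' d(1) by auto
          next
            case 3
            then show ?thesis using hB[OF xy(2)] g(2) rad_opp2(2)[OF d(1)] by auto
          qed
        qed
        then have "\<forall>a\<in>S0. E w1 a \<or> E w2 a \<longrightarrow> h g a \<noteq> d" by blast
        moreover have "rad (g y) = 2" using g(2) rad_opp2(1)[OF d(1)] by simp
        ultimately show ?thesis using fin[OF g(1)] False d(1) by blast
      next
        case no: False
        have ex: "\<exists>a\<in>A. E w2 a \<and> f a = d" if "rad d = 2" for d using no that by blast
        \<comment> \<open>The colours 4 and 5 exhaust the degree of \<open>w2\<close>, so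
          \<open>w2\<close> itself can switch to \<open>c\<close>.\<close>
        obtain p q where pq: "p \<in> A" "q \<in> A" "E w2 p" "E w2 q" "f p = 4" "f q = 5"
          using ex[OF rad_simps(3)] ex[OF rad_simps(4)] by blast
        have "p \<noteq> q" using pq(5,6) by auto
        moreover have "p \<in> S0" "q \<in> S0" unfolding AB(1)[symmetric] using pq(1,2) by blast+
        ultimately have "p \<in> S0" "q \<in> S0" "p \<noteq> q" by blast+
        note w = w2_two_nbrs[OF this(1,2) pq(3,4) this(3)]
        have "h g0 a \<noteq> c" if "a \<in> S0" "E w2 a" for a
        proof -
          have "a = p \<or> a = q" using w(2)[OF that(2)] that(1) by blast
          then have "h g0 a = 4 \<or> h g0 a = 5" using hA[OF pq(1), of g0] hA[OF pq(2), of g0] pq(5,6) by metis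
          then show ?thesis using c by auto
        qed
        then have "\<forall>a\<in>S0. E w2 a \<longrightarrow> h g0 a \<noteq> c" by blast
        with w(1) show ?thesis using fin[OF g0 y2] False by blast
      qed
    qed
  qed
qed

end

context subcubic_adjacency begin

section \<open>The induction\<close>

theorem ex_good:
  assumes "finite S" "conn S" "z \<in> S" "E z u" "u \<notin> S"
  shows "\<exists>f. good S z f"
  using assms
proof (induction "card S" arbitrary: S z u rule: less_induct)
  case (less S v u)
  have IH: "\<exists>f. good A a f" if "A \<subset> S" "conn A" "a \<in> A" "E a b" "b \<notin> A" for A a b
    using less.hyps[of A a b] that less.prems(1) psubset_card_mono[OF less.prems(1) that(1)]
      finite_subset[of A S] by blast
  show ?case
  proof (cases "S = {v}")
    case True
    have "good {v} v (\<lambda>_. 2)"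
      by (rule goodI) (auto simp: valid_def adj_irrefl)
    then show ?thesis using True by blast
  next
    case False
    then obtain w1 where w1: "w1 \<in> S" "E v w1"
      using conn_nbr[OF less.prems(2,3)] by blast
    show ?thesis
    proof (cases "\<exists>w2\<in>S. E v w2 \<and> w2 \<noteq> w1")
      case no: False
      then have leaf: "a = w1" if "a \<in> S" "E v a" for a using that by blast
      have "conn (S - {v})"
        by (rule conn_remove_leaf[OF less.prems(2,3)]) (use leaf in blast)
      moreover have "w1 \<in> S - {v}" using w1 adj_irrefl by auto
      moreover have "S - {v} \<subset> S" using less.prems(3) by blast
      ultimately obtain f where "good (S - {v}) w1 f"
        using IH[of "S - {v}" w1 v] adj_sym[OF w1(2)] by blast
      then show ?thesis using extend_leaf[OF less.prems(3) w1 leaf] by blast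
    next
      case True
      then obtain w2 where w2: "w2 \<in> S" "E v w2" "w1 \<noteq> w2" by blast
      interpret pending_vertex E S v w1 w2 u
        using less.prems w1 w2 by unfold_locales auto
      have nv: "a = w1 \<or> a = w2" if "a \<in> S" "E v a" for a
        using nbr_v[OF that(2)] that(1) less.prems(5) by blast
      have sub: "S - {v} \<subset> S" "S0 \<subset> S" using less.prems(3) by auto
      show ?thesis
      proof (cases "conn (S - {v})")
        case False
        obtain A B where AB: "A \<union> B = S - {v}" "A \<inter> B = {}" "\<And>a b. a \<in> A \<Longrightarrow> b \<in> B \<Longrightarrow> \<not> E a b"
          and cn: "conn A" "conn B" and w: "w1 \<in> A" "w2 \<in> B"
          using conn_split[OF less.prems(2,3) nv False] by blast
        have "A \<subset> S" "B \<subset> S" "v \<notin> A" "v \<notin> B" using AB(1) sub(1) by auto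
        then obtain f g where "good A w1 f" "good B w2 g"
          using IH[OF _ cn(1) w(1) adj_sym[OF adj_v(1)]] IH[OF _ cn(2) w(2) adj_sym[OF adj_v(2)]] by blast
        then show ?thesis
          using extend_cut[OF less.prems(3) AB w adj_v(1,2) nv] by blast
      next
        case conn_v: True
        have w1': "w1 \<in> S - {v}" using w1 v_neq_w1 by auto
        have w2': "w2 \<in> S0" by (rule w2_S0)
        have S0_eq: "S - {v} - {w1} = S0" by auto
        obtain x where x: "x \<in> S0" "E w1 x"
          using conn_nbr[OF conn_v w1'] w2' by blast
        show ?thesis
        proof (cases "\<exists>y\<in>S0. E w1 y \<and> y \<noteq> x")
          case False
          then have leaf: "a = x" if "a \<in> S0" "E w1 a" for a using that by blast
          have "conn S0"
            unfolding S0_eq[symmetric]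
            by (rule conn_remove_leaf[OF conn_v w1']) (use leaf v_neq_w1 adj_irrefl in blast)
          then obtain f where f: "good S0 w2 f"
            using IH[OF sub(2) _ w2' adj_sym[OF adj_v(2)]] by blast
          have x1: "rad (f x) = 1 \<or> x = w2"
            using good_boundary[OF f x(1) adj_sym[OF x(2)]] by blast
          obtain c where "rad c = 1" "f x \<noteq> c"
            using rad_simps(1,2) by (metis numeral_eq_iff semiring_norm(88))
          then show ?thesis
            using extend_uncolored_pair_one[OF partial_good[OF f]] leaf x1 by blast
        next
          case True
          then obtain y where y: "y \<in> S0" "E w1 y" "x \<noteq> y" by blast
          have nb: "a = x \<or> a = y" if "a \<in> S0" "E w1 a" for a
            using nbr_cases[of w1 v x y a] adj_sym[OF adj_v(1)] x y that by auto
          show ?thesis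
          proof (cases "conn S0")
            case False
            have nb': "a = x \<or> a = y" if "a \<in> S - {v}" "E w1 a" for a
              using nb[of a] that adj_irrefl by blast
            have "\<not> conn (S - {v} - {w1})" using False unfolding S0_eq .
            then have "\<exists>A B. A \<union> B = S - {v} - {w1} \<and> A \<inter> B = {} \<and> (\<forall>a\<in>A. \<forall>b\<in>B. \<not> E a b) \<and>
                conn A \<and> conn B \<and> x \<in> A \<and> y \<in> B"
              using nb' by (intro conn_split[OF conn_v w1'])
            then obtain A B where AB: "A \<union> B = S0" "A \<inter> B = {}" "\<forall>a\<in>A. \<forall>b\<in>B. \<not> E a b"
              and cn: "conn A" "conn B" and w: "x \<in> A" "y \<in> B"
              unfolding S0_eq by (elim exE conjE) (rule that)
            have "A \<subseteq> S0" "B \<subseteq> S0" using AB(1) by blast+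
            then have AB': "A \<subset> S" "B \<subset> S" "v \<notin> A" "v \<notin> B" "w1 \<notin> A" "w1 \<notin> B"
              using sub(2) by blast+
            have sep: "\<not> E a b" "\<not> E b a" if "a \<in> A" "b \<in> B" for a b
              using AB(3) that adj_sym by blast+
            show ?thesis
            proof (cases "w2 \<in> A")
              case True
              obtain f where f: "good A w2 f"
                using IH[OF AB'(1) cn(1) True adj_sym[OF adj_v(2)] AB'(3)] by blast
              obtain g where g: "good B y g"
                using IH[OF AB'(2) cn(2) w(2) adj_sym[OF y(2)] AB'(6)] by blast
              show ?thesis
                by (rule extend_split[OF AB(1,2) _ w x(2) y(2) True _ f g]) (use sep nb in blast)+
            next
              case False
              then have B: "w2 \<in> B" using w2' AB(1) by blast
              obtain f where f: "good B w2 f"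
                using IH[OF AB'(2) cn(2) B adj_sym[OF adj_v(2)] AB'(4)] by blast
              obtain g where g: "good A x g"
                using IH[OF AB'(1) cn(1) w(1) adj_sym[OF x(2)] AB'(5)] by blast
              have BA: "B \<union> A = S0" "B \<inter> A = {}" using AB(1,2) by blast+
              show ?thesis
                by (rule extend_split[OF BA _ w(2,1) y(2) x(2) B _ f g]) (use sep nb in blast)+
            qed
          next
            case True
            then have "\<exists>f. good S0 w2 f"
              using IH[OF sub(2) _ w2' adj_sym[OF adj_v(2)]] by blast
            then obtain f where f: "good S0 w2 f" "saturated S0 f"
              using good_saturate[OF _ w2'] less.prems(1) by blast
            have x1: "rad (f x) = 1 \<or> x = w2" and y1: "rad (f y) = 1 \<or> y = w2"
              using good_boundary[OF f(1) x(1) adj_sym[OF x(2)]] good_boundary[OF f(1) y(1) adj_sym[OF y(2)]]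
              by blast+
            show ?thesis
            proof (rule ccontr)
              assume no: "\<not> ?thesis"
              have "rad (f x) = 1 \<and> rad (f y) = 1 \<and> f x \<noteq> f y"
              proof (rule ccontr)
                assume c: "\<not> ?thesis"
                \<comment> \<open>\<open>e\<close> is the only colour of class 1 on \<open>x\<close>
                  and \<open>y\<close>: if \<open>f x\<close> has another class, then
                  \<open>x = w2\<close>, so \<open>y\<close> is not \<open>w2\<close> and has class
                  1.\<close>
                define e where "e = (if rad (f x) = 1 then f x else f y)"
                have e: "rad e = 1" using x1 y1 y(3) by (auto simp: e_def)
                have "f a \<noteq> 5 - e \<and> (rad (f a) = 1 \<or> a = w2)" if "a \<in> S0" "E w1 a" for a
                proof (cases "rad (f a) = 1")
                  case True
                  then have "f a = e" using nb[OF that] c unfolding e_def by metis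
                  then show ?thesis using True rad_opp(2)[OF e] by simp
                next
                  case False
                  moreover from this have "f a \<noteq> 5 - e" using rad_opp(1)[OF e] by metis
                  ultimately show ?thesis using nb[OF that] x1 y1 by metis
                qed
                then show False
                  using extend_uncolored_pair_one[OF partial_good[OF f(1)] rad_opp(1)[OF e]] no by blast
              qed
              then interpret stuck E S v w1 w2 u x y f
                using x y f no by unfold_locales auto
              show False by (rule never_stuck)
            qed
          qed
        qed
      qed
    qed
  qed
qed

section \<open>Colouring all vertices but one\<close>

lemma near_Suc: "near k a b \<Longrightarrow> near (Suc k) a b"
  by (induction k arbitrary: a) auto

lemma near_mono: "k \<le> l \<Longrightarrow> near k a b \<Longrightarrow> near l a b"
  by (induction rule: dec_induct) (auto intro: near_Suc simp del: near.simps(2))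

lemma ex_valid_but_one:
  assumes "finite V" "conn V" "V \<noteq> {}"
  shows "\<exists>r\<in>V. \<exists>f. valid (V - {r}) f"
proof -
  obtain r where r: "r \<in> V" "conn (V - {r})" using ex_noncut assms by blast
  show ?thesis
  proof (cases "V = {r}")
    case True
    then show ?thesis by (auto simp: valid_def)
  next
    case False
    \<comment> \<open>The edge from \<open>z\<close> to \<open>r\<close> leaves the connected set
      \<open>V - {r}\<close>, as \<open>ex_good\<close> requires.\<close>
    then obtain z where z: "z \<in> V - {r}" "E r z" using conn_nbr[OF assms(2) r(1)] by blast
    then show ?thesis
      using ex_good[of "V - {r}" z r] assms(1) r adj_sym good_valid by blast
  qed
qed

end

section \<open>Transfer to the subdivision\<close>

lemma subcubic_adjacency_pair_graph:
  assumes "pair_graph G" "subcubic (with_proj G)"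
  shows "subcubic_adjacency (\<lambda>a b. (a, b) \<in> parcs G)"
proof -
  interpret pair_graph G by fact
  have img: "{b. (a, b) \<in> parcs G} = snd ` out_arcs (with_proj G) a" for a
    by (force simp: out_arcs_def)
  have fin: "finite (out_arcs (with_proj G) a)" for a
    using pair_finite_arcs by (auto simp: out_arcs_def)
  show ?thesis
  proof
    fix a b
    show "(b, a) \<in> parcs G" if "(a, b) \<in> parcs G"
      using that pair_sym_arcs by (simp add: symmetric_def symD)
    show "(a, a) \<notin> parcs G" using pair_no_loops by fastforce
    show "finite {b. (a, b) \<in> parcs G}" unfolding img using fin by blast
    show "card {b. (a, b) \<in> parcs G} \<le> 3"
    proof (cases "a \<in> pverts G")
      case True
      then have "card (out_arcs (with_proj G) a) \<le> 3"
        using assms(2) by (auto simp: subcubic_def out_degree_def)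
      then show ?thesis unfolding img using card_image_le[OF fin] le_trans by blast
    next
      case False
      then have "{b. (a, b) \<in> parcs G} = {}" using in_arcsD1 by blast
      then show ?thesis by simp
    qed
  qed
qed

lemma conn_pair_graph:
  assumes "pair_graph G" "subcubic (with_proj G)" "connected (with_proj G)"
  shows "subcubic_adjacency.conn (\<lambda>a b. (a, b) \<in> parcs G) (pverts G)"
proof -
  interpret pair_graph G by fact
  interpret A: subcubic_adjacency "\<lambda>a b. (a, b) \<in> parcs G"
    by (rule subcubic_adjacency_pair_graph) fact+
  have sym: "(b, a) \<in> parcs G" if "(a, b) \<in> parcs G" for a b using A.adj_sym that .
  show ?thesis
    unfolding A.conn_def
  proof (intro allI impI, rule ccontr)
    fix C assume C: "C \<subseteq> pverts G" "C \<noteq> {}" "C \<noteq> pverts G"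
      and closed: "\<not> (\<exists>a\<in>C. \<exists>b\<in>pverts G - C. (a, b) \<in> parcs G)"
    obtain a b where ab: "a \<in> C" "b \<in> pverts G - C" using C by blast
    have "(a, b) \<in> rtrancl_on (pverts G) (parcs (mk_symmetric (with_proj G)))"
      using assms(3) ab C(1) unfolding connected_def strongly_connected_def reachable_def by auto
    then have "b \<in> C"
    proof (induction rule: rtrancl_on_induct)
      case base
      show ?case using ab by blast
    next
      case (step c d)
      then have "(c, d) \<in> parcs G"
        using sym by (auto simp: parcs_mk_symmetric)
      then show ?case using step closed in_arcsD2 by blast
    qed
    then show False using ab by blast
  qed
qed

text \<open>The walk is read two arcs at a time: passing a subdivision vertex either follows an edge
  of \<open>G\<close> or turns back, which \<open>near\<close> permits.\<close>

lemma awalk_subdivide_edges: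
  assumes "pair_graph G" "subcubic (with_proj G)"
    and "pre_digraph.awalk (with_proj (subdivide_edges G)) (Inl a) p (Inl b)"
  shows "\<exists>k. length p = 2 * k \<and> subcubic_adjacency.near (\<lambda>a b. (a, b) \<in> parcs G) k a b"
proof -
  interpret D: pair_graph "subdivide_edges G" using pair_graph_subdivide_edges assms(1) .
  interpret A: subcubic_adjacency "\<lambda>a b. (a, b) \<in> parcs G"
    by (rule subcubic_adjacency_pair_graph) fact+
  show ?thesis
    using assms(3)
  proof (induction p arbitrary: a rule: length_induct)
    case (1 p)
    show ?case
    proof (cases p)
      case Nil
      then show ?thesis using 1(2) by (auto simp: D.awalk_Nil_iff)
    next
      case (Cons e p')
      then have e: "e \<in> parcs (subdivide_edges G)" "fst e = Inl a" "D.awalk (snd e) p' (Inl b)"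
        using 1(2) by (auto simp: D.awalk_Cons_iff)
      obtain y where y: "(a, y) \<in> parcs G" "snd e = Inr {a, y}"
        using e(1,2) by (auto simp: subdivide_edges_def)
      show ?thesis
      proof (cases p')
        case Nil
        then show ?thesis using e(3) y(2) by (auto simp: D.awalk_Nil_iff)
      next
        case (Cons e' p'')
        then have e': "e' \<in> parcs (subdivide_edges G)" "fst e' = Inr {a, y}" "D.awalk (snd e') p'' (Inl b)"
          using e(3) y(2) by (auto simp: D.awalk_Cons_iff)
        obtain c where c: "snd e' = Inl c" "c = a \<or> c = y"
          using e'(1,2) by (auto simp: subdivide_edges_def doubleton_eq_iff)
        have "length p'' < length p" using \<open>p = e # p'\<close> Cons by simp
        with 1(1) e'(3) c(1) obtain k where k: "length p'' = 2 * k" "A.near k c b"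
          by auto
        have "A.near (Suc k) a b"
          using c(2) k(2) y(1) A.near_Suc by auto
        then show ?thesis using k(1) \<open>p = e # p'\<close> Cons by (intro exI[of _ "Suc k"]) simp
      qed
    qed
  qed
qed

theorem theorem1:
  fixes G :: "'a pair_pre_digraph"
  assumes "pair_graph G"
    and "connected (with_proj G)"
    and "subcubic (with_proj G)"
  shows "\<exists>V. packing_coloring 8 (with_proj (subdivide_edges G)) V \<and> card (V 8) \<le> 1"
proof -
  interpret G: pair_graph G by fact
  interpret D: pair_graph "subdivide_edges G" using pair_graph_subdivide_edges assms(1) .
  interpret A: subcubic_adjacency "\<lambda>a b. (a, b) \<in> parcs G"
    by (rule subcubic_adjacency_pair_graph) fact+
  have "pverts G \<noteq> {}"
    using assms(2) unfolding connected_def strongly_connected_def by simp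
  then obtain r f where r: "r \<in> pverts G" and f: "A.valid (pverts G - {r}) f"
    using A.ex_valid_but_one[OF G.pair_finite_verts conn_pair_graph[OF assms(1,3,2)]] by blast
  define V :: "nat \<Rightarrow> ('a + 'a set) set" where
    "V i = (if i = 1 then {Inr {x, y} | x y. (x, y) \<in> parcs G}
            else if i = 8 then {Inl r} else Inl ` {a \<in> pverts G - {r}. f a = i})" for i
  have range: "f a \<in> {2..7}" if "a \<in> pverts G" "a \<noteq> r" for a
    using A.valid_range[OF f] that by blast
  have "disjoint_family_on V {1..8}"
    unfolding disjoint_family_on_def V_def by auto
  moreover have "(\<Union>i\<in>{1..8}. V i) = verts (with_proj (subdivide_edges G))"
  proof
    show "(\<Union>i\<in>{1..8}. V i) \<subseteq> verts (with_proj (subdivide_edges G))"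
      using r by (auto simp: V_def subdivide_edges_def split: if_splits)
    show "verts (with_proj (subdivide_edges G)) \<subseteq> (\<Union>i\<in>{1..8}. V i)"
    proof
      fix u assume "u \<in> verts (with_proj (subdivide_edges G))"
      then consider "u \<in> V 1" | "u \<in> V 8" | a where "u = Inl a" "a \<in> pverts G" "a \<noteq> r"
        by (auto simp: V_def subdivide_edges_def)
      then show "u \<in> (\<Union>i\<in>{1..8}. V i)"
      proof cases
        case (3 a)
        then have "u \<in> V (f a)" "f a \<in> {1..8}" using range[of a] by (auto simp: V_def)
        then show ?thesis by blast
      qed force+
    qed
  qed
  moreover have "ereal (real i + 1) \<le> graph_dist (with_proj (subdivide_edges G)) u v"
    if i: "i \<in> {1..8}" and uv: "u \<in> V i" "v \<in> V i" "u \<noteq> v" for i u v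
  proof -
    have "Suc i \<le> length p" if p: "D.awalk u p v" for p
    proof -
      consider "i = 1" | "i \<noteq> 1" "i \<noteq> 8" | "i = 8" by blast
      then show ?thesis
      proof cases
        case 1
        then obtain e e' where "u = Inr e" "v = Inr e'" using uv by (auto simp: V_def)
        moreover have "(Inr e, Inr e') \<notin> parcs (subdivide_edges G)"
          by (auto simp: subdivide_edges_def)
        ultimately show ?thesis
          \<comment> \<open>Walks with no arc or one arc are excluded, so the length is at least
            2.\<close>
          using p uv(3) 1 by (cases p; cases "tl p") (auto simp: D.awalk_simps)
      next
        case 2
        then obtain a b where ab: "u = Inl a" "v = Inl b" "a \<in> pverts G - {r}" "b \<in> pverts G - {r}"
          "f a = i" "f b = i"
          using uv(1,2) by (auto simp: V_def)
        obtain k where k: "length p = 2 * k" "A.near k a b"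
          using awalk_subdivide_edges[OF assms(1,3)] p ab(1,2) by blast
        have "\<not> A.near (rad i) a b"
          using A.validD[OF f ab(3,4)] ab uv(3) by auto
        then have "\<not> k \<le> rad i" using A.near_mono k(2) by blast
        \<comment> \<open>\<open>k > i div 2\<close> gives \<open>2 * k \<ge> i + 1\<close>, which
          is why \<open>rad\<close> halves the colour.\<close>
        then show ?thesis using k(1) unfolding rad_def by linarith
      next
        case 3
        then show ?thesis using uv by (simp add: V_def)
      qed
    qed
    then have "ereal (real (Suc i)) \<le> graph_dist (with_proj (subdivide_edges G)) u v"
      unfolding D.le_graph_dist_iff by blast
    then show ?thesis by (simp add: add.commute)
  qed
  ultimately have "packing_coloring 8 (with_proj (subdivide_edges G)) V"
    unfolding packing_coloring_def by blast
  moreover have "card (V 8) \<le> 1" by (simp add: V_def)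
  ultimately show ?thesis by blast
qed

end
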